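(* Let $\mathbb{B}$ be a (real) Banach space and $E\subseteq\mathbb{B}$ a $\sigma$-compact set. Let $f\in \mathrm{LIP}_b(\mathbb{B})$ and $\varepsilon>0$ be given. Then there exists a sequence $(f_n)_{n\in\mathbb{N}}\subseteq \mathrm{Cyl}(\mathbb{B})$ such that the following properties hold: (i) $\inf_{\mathbb{B}} f\le f_n\le \sup_{\mathbb{B}} f$ on $\mathbb{B}$ and $\mathrm{Lip}(f_n)\le \mathrm{Lip}(f)+\varepsilon$ for every $n\in\mathbb{N}$. (ii) $\lim_{n} f_n(x)=f(x)$ for every $x\in E$. (iii) $\limsup_{n}\|\mathrm{d}_x f_n\|_{\mathbb{B}^*}\le \mathrm{lip}_a(f)(x)$ for every $x\in E$.
   Context: For a metric space $(X,d)$, $\mathrm{LIP}_b(X)$ denotes the space of all bounded real-valued Lipschitz functions on $X$. For a real-valued Lipschitz function $f$ on $X$ and a set $A\subseteq X$, $\mathrm{Lip}(f;A)$ denotes the Lipschitz constant of $f$ on $A$, and $\mathrm{Lip}(f):=\mathrm{Lip}(f;X)$. The asymptotic slope $\mathrm{lip}_a(f):X\to[0,\mathrm{Lip}(f)]$ is defined by $\mathrm{lip}_a(f)(x):=\inf_{r>0}\mathrm{Lip}(f;B_r(x))$ for every $x\in X$, where $B_r(x)$ is the open ball of center $x$ and radius $r$. For a Banach space $\mathbb{B}$, $\mathbb{B}^*$ is its dual, $C^\infty(\mathbb{B})$ is the space of smooth (i.e. infinitely Fréchet differentiable) functions $f:\mathbb{B}\to\mathbb{R}$, and $\mathrm{d}_x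 f\in\mathbb{B}^*$ is the Fréchet differential of $f$ at $x$. The space of smooth cylindrical functions $\mathrm{Cyl}(\mathbb{B})$ is the set of all functions of the form $g\circ p:\mathbb{B}\to\mathbb{R}$, where $\mathbb{V}$ is a finite-dimensional Banach space, $p:\mathbb{B}\to\mathbb{V}$ is a bounded linear operator, and $g\in C^\infty(\mathbb{V})\cap \mathrm{LIP}_b(\mathbb{V})$. A set is $\sigma$-compact if it is a countable union of compact sets. *)

theory Defs
  imports "HOL-Analysis.Analysis"
begin

definition sigma_compact :: "'a::topological_space set \<Rightarrow> bool" where
  "sigma_compact E \<longleftrightarrow> (\<exists>\<K>. countable \<K> \<and> (\<forall>K\<in>\<K>. compact K) \<and> E = \<Union>\<K>)"


section \<open>Lipschitz functions\<close>

text \<open>The bounded Lipschitz functions on the metric space carried by a set; functions are total,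
  so only their values on that set matter.\<close>

definition LIP\<^sub>b :: "'a::metric_space set \<Rightarrow> ('a \<Rightarrow> real) set" where
  "LIP\<^sub>b X = {f. bounded (f ` X) \<and> (\<exists>L. L-lipschitz_on X f)}"

text \<open>The least Lipschitz constant. This is meaningful only if \<open>f\<close> is Lipschitz on \<open>A\<close>; otherwise
  it is the unspecified infimum of the empty set. The constants ranging in the infimum are
  nonnegative by definition of \<^const>\<open>lipschitz_on\<close>.\<close>

definition Lip :: "('a::metric_space \<Rightarrow> real) \<Rightarrow> 'a set \<Rightarrow> real" where
  "Lip f A = Inf {L. L-lipschitz_on A f}"

definition lip\<^sub>a :: "('a::metric_space \<Rightarrow> real) \<Rightarrow> 'a \<Rightarrow> real" where
  "lip\<^sub>a f x = (INF r\<in>{0<..}. Lip f (ball x r))"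


section \<open>Smooth functions\<close>

text \<open>Bounded \<open>k\<close>-linear forms on a subspace \<open>V\<close>, with arguments given as lists of length \<open>k\<close>.\<close>

definition bounded_multilinear_form ::
    "'a::real_normed_vector set \<Rightarrow> nat \<Rightarrow> ('a list \<Rightarrow> real) \<Rightarrow> bool" where
  "bounded_multilinear_form V k M \<longleftrightarrow>
     (\<forall>vs\<in>lists V. length vs = k \<longrightarrow>
        (\<forall>i<k. (\<forall>u\<in>V. \<forall>w\<in>V. M (vs[i := u + w]) = M (vs[i := u]) + M (vs[i := w])) \<and>
               (\<forall>u\<in>V. \<forall>c. M (vs[i := c *\<^sub>R u]) = c * M (vs[i := u])))) \<and>
     (\<exists>C. \<forall>vs\<in>lists V. length vs = k \<longrightarrow> \<bar>M vs\<bar> \<le> C * (\<Prod>v\<leftarrow>vs. norm v))"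

text \<open>Infinite Frechet differentiability of a function on the normed space \<open>V\<close>, a linear subspace
  of an ambient space. The iterated derivatives take values in the spaces
  \<open>L(V, L(V, \<dots>))\<close>, whose types vary with the order. They are therefore identified with spaces of
  bounded multilinear forms: \<open>D k x\<close> is the \<open>k\<close>-th derivative at \<open>x\<close>, and the last
  clause says that \<open>D (Suc k) x\<close> is the Frechet derivative of \<open>D k\<close> at \<open>x\<close> with respect to the
  operator norm (the estimate is uniform in \<open>vs\<close>). The new direction is put first.\<close>

definition smooth_on :: "'a::real_normed_vector set \<Rightarrow> ('a \<Rightarrow> real) \<Rightarrow> bool" where
  "smooth_on V f \<longleftrightarrow>
     (\<exists>D :: nat \<Rightarrow> 'a \<Rightarrow> 'a list \<Rightarrow> real.
        (\<forall>x\<in>V. D 0 x [] = f x) \<and>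
        (\<forall>k. \<forall>x\<in>V. bounded_multilinear_form V k (D k x)) \<and>
        (\<forall>k. \<forall>x\<in>V. \<forall>e>0. \<forall>\<^sub>F y in at x within V.
           \<forall>vs\<in>lists V. length vs = k \<longrightarrow>
             \<bar>D k y vs - D k x vs - D (Suc k) x ((y - x) # vs)\<bar>
               \<le> e * norm (y - x) * (\<Prod>v\<leftarrow>vs. norm v)))"


section \<open>Smooth cylindrical functions\<close>

text \<open>The definition of cylindrical functions quantifies over all finite-dimensional Banach spaces.
  Since types cannot be quantified in a formula, these are represented as the finite-dimensional
  subspaces of \<open>\<ell>\<^sup>\<infinity>\<close>, i.e. of the bounded (trivially continuous) functions on \<open>nat\<close> with
  the supremum norm: every separable, in particular every finite-dimensional, real Banach space is
  isometrically isomorphic to a subspace of \<open>\<ell>\<^sup>\<infinity>\<close>.\<close>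

type_synonym linf = "nat \<Rightarrow>\<^sub>C real"

definition Cyl :: "('b::real_normed_vector \<Rightarrow> real) set" where
  "Cyl = {g \<circ> p | (g :: linf \<Rightarrow> real) p V.
            (\<exists>B. finite B \<and> V = span B) \<and>
            bounded_linear p \<and> range p \<subseteq> V \<and>
            smooth_on V g \<and> g \<in> LIP\<^sub>b V}"

end

theory Submission
  imports Defs
begin

text \<open>On a compact set \<open>K\<close>, approximate \<open>f\<close> by a McShane-type minimum over a finite net of cones
  \<open>f t + c\<^sub>t (p (x - t))\<close>. Here \<open>p\<close> is a maximum of finitely many functionals which almost norm the
  differences of points of \<open>K\<close> (Hahn-Banach), and \<open>c\<^sub>t\<close> has slope \<open>Lip f (ball t r) + \<eta>\<close> up to
  distance \<open>r / 2\<close> and slope \<open>Lip f UNIV + 2 * \<eta>\<close> beyond. Since Banach spaces are geodesic, each cone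
  exceeds \<open>f x\<close> by about \<open>\<eta> * norm (x - t)\<close> at \<open>x \<in> K\<close>, so only cones with apex close to
  \<open>x\<close> are nearly active there, and these have slope at most \<open>Lip f (ball x (2 * r)) + \<eta>\<close>.
  All minima and maxima are replaced by log-sum-exp, which only depends on finitely many functionals;
  its gradient is a convex combination of the slopes up to exponentially small weights of the
  inactive branches. Exhausting \<open>E\<close> by compact sets and letting \<open>r, \<eta>\<close> tend to \<open>0\<close> gives the
  sequence.\<close>

section \<open>Norming functionals\<close>

definition sublinear :: "('a::real_vector \<Rightarrow> real) \<Rightarrow> bool" where
  "sublinear q \<longleftrightarrow> (\<forall>x y. q (x + y) \<le> q x + q y) \<and> (\<forall>c\<ge>0. \<forall>x. q (c *\<^sub>R x) = c * q x)"

text \<open>The one-sided inequality, applied to the factor \<open>1 / c\<close>, yields its own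
  reverse.\<close>

lemma sublinearI:
  assumes "\<And>x y. q (x + y) \<le> q x + q y"
    and "\<And>c x. c > 0 \<Longrightarrow> q (c *\<^sub>R x) \<le> c * q x"
    and "q 0 = 0"
  shows "sublinear q"
  unfolding sublinear_def
proof (intro conjI allI impI)
  fix c :: real and x assume "c \<ge> 0"
  show "q (c *\<^sub>R x) = c * q x"
  proof (cases "c = 0")
    case False
    with \<open>c \<ge> 0\<close> have c: "c > 0" by simp
    have "q ((1/c) *\<^sub>R (c *\<^sub>R x)) \<le> (1/c) * q (c *\<^sub>R x)"
      using c by (intro assms(2)) simp
    then have "c * q x \<le> q (c *\<^sub>R x)"
      using c by (simp add: field_simps)
    with assms(2)[OF c, of x] show ?thesis by simp
  qed (simp add: assms(3))
qed (rule assms(1))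

lemma sublinear_add: "sublinear q \<Longrightarrow> q (x + y) \<le> q x + q y"
  and sublinear_scale: "sublinear q \<Longrightarrow> c \<ge> 0 \<Longrightarrow> q (c *\<^sub>R x) = c * q x"
  by (auto simp: sublinear_def)

lemma sublinear_zero: "sublinear q \<Longrightarrow> q 0 = 0"
  using sublinear_scale[of q 0 0] by simp

lemma sublinear_minus: "sublinear q \<Longrightarrow> - q (- x) \<le> q x"
  using sublinear_add[of q x "- x"] by (simp add: sublinear_zero)

lemma sublinear_norm: "sublinear (norm :: 'a::real_normed_vector \<Rightarrow> real)"
  by (simp add: sublinear_def norm_triangle_ineq)

text \<open>The infimum over \<open>t \<ge> 0\<close> of \<open>q (x + t *\<^sub>R y) - t * q y\<close> is the largest such \<open>q'\<close>. A functional
  that cannot be lowered in this way is odd, hence linear; lowering the norm in this way at \<open>v\<close>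
  ensures that every linear minorant attains \<open>norm v\<close> at \<open>v\<close>.\<close>

lemma sublinear_tilt:
  fixes q :: "'a::real_vector \<Rightarrow> real"
  assumes q: "sublinear q"
  obtains q' where "sublinear q'" "q' \<le> q" "q' (- y) \<le> - q y"
proof
  define q' where "q' x = (INF t\<in>{0..}. q (x + t *\<^sub>R y) - t * q y)" for x
  \<comment> \<open>Subadditivity gives a lower bound that does not depend on \<open>t\<close>, so
    the infimum is finite.\<close>
  have lower: "- q (- x) \<le> q (x + t *\<^sub>R y) - t * q y" if "t \<ge> 0" for x t
    using sublinear_add[OF q, of "x + t *\<^sub>R y" "- x"] sublinear_scale[OF q that, of y] by simp
  have bdd: "bdd_below ((\<lambda>t. q (x + t *\<^sub>R y) - t * q y) ` {0..})" for x
    by (rule bdd_belowI[of _ "- q (- x)"]) (use lower in auto)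
  have upper: "q' x \<le> q (x + t *\<^sub>R y) - t * q y" if "t \<ge> 0" for x t
    unfolding q'_def using that by (intro cINF_lower bdd) auto
  have greatest: "z \<le> q' x" if "\<And>t. t \<ge> 0 \<Longrightarrow> z \<le> q (x + t *\<^sub>R y) - t * q y" for z x
    unfolding q'_def using that by (intro cINF_greatest) auto
  \<comment> \<open>The parameter \<open>0\<close> gives \<open>q' \<le> q\<close>, and the
    parameter \<open>1\<close> gives the bound at \<open>- y\<close>.\<close>
  show le: "q' \<le> q"
    using upper[of 0] by (simp add: le_fun_def)
  show "q' (- y) \<le> - q y"
    using upper[of 1 "- y"] by (simp add: sublinear_zero[OF q])
  show "sublinear q'"
  proof (rule sublinearI)
    fix u v
    \<comment> \<open>Two nested infima: \<open>t\<close> belongs to \<open>v\<close> and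
      \<open>s\<close> to \<open>u\<close>, and \<open>s + t\<close> is admissible for
      \<open>u + v\<close>.\<close>
    have "q' (u + v) - (q (v + t *\<^sub>R y) - t * q y) \<le> q' u" if t: "t \<ge> 0" for t
    proof (rule greatest)
      fix s :: real assume s: "s \<ge> 0"
      have "q' (u + v) \<le> q (u + v + (s + t) *\<^sub>R y) - (s + t) * q y"
        using s t by (intro upper) simp
      also have "u + v + (s + t) *\<^sub>R y = (u + s *\<^sub>R y) + (v + t *\<^sub>R y)"
        by (simp add: algebra_simps)
      finally show "q' (u + v) - (q (v + t *\<^sub>R y) - t * q y) \<le> q (u + s *\<^sub>R y) - s * q y"
        using sublinear_add[OF q, of "u + s *\<^sub>R y" "v + t *\<^sub>R y"] by (simp add: algebra_simps)
    qed
    then have "q' (u + v) - q' u \<le> q' v"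
      by (intro greatest) (simp add: algebra_simps)
    then show "q' (u + v) \<le> q' u + q' v" by simp
  next
    fix c :: real and x assume c: "c > 0"
    have "q' (c *\<^sub>R x) / c \<le> q' x"
    proof (rule greatest)
      fix t :: real assume t: "t \<ge> 0"
      have "q' (c *\<^sub>R x) \<le> q (c *\<^sub>R x + (c * t) *\<^sub>R y) - (c * t) * q y"
        using c t by (intro upper) simp
      also have "c *\<^sub>R x + (c * t) *\<^sub>R y = c *\<^sub>R (x + t *\<^sub>R y)"
        by (simp add: algebra_simps)
      also have "q (c *\<^sub>R (x + t *\<^sub>R y)) = c * q (x + t *\<^sub>R y)"
        using c by (intro sublinear_scale[OF q]) simp
      finally show "q' (c *\<^sub>R x) / c \<le> q (x + t *\<^sub>R y) - t * q y"
        using c by (simp add: field_simps)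
    qed
    then show "q' (c *\<^sub>R x) \<le> c * q' x"
      using c by (simp add: field_simps)
  next
    have "0 \<le> q' 0"
      by (rule greatest) (simp add: sublinear_scale[OF q])
    with le show "q' 0 = 0"
      using sublinear_zero[OF q] by (simp add: le_fun_def antisym) (metis antisym)
  qed
qed

text \<open>Supplies the lower bounds of chains for Zorn's lemma. The pointwise infimum is finite
  because all members lie above \<open>- q0 (- x)\<close>; it stays subadditive because the smaller
  of two members can serve both arguments.\<close>

lemma sublinear_INF_chain:
  fixes C :: "('a::real_vector \<Rightarrow> real) set"
  assumes sub: "\<And>q. q \<in> C \<Longrightarrow> sublinear q \<and> q \<le> q0"
    and chain: "\<And>p q. p \<in> C \<Longrightarrow> q \<in> C \<Longrightarrow> p \<le> q \<or> q \<le> p"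
    and "C \<noteq> {}"
  obtains u where "sublinear u" "\<And>q. q \<in> C \<Longrightarrow> u \<le> q"
proof
  define u where "u x = (INF q\<in>C. q x)" for x
  have bdd: "bdd_below ((\<lambda>q. q x) ` C)" for x
  proof (rule bdd_belowI2[of _ "- q0 (- x)"])
    fix q assume "q \<in> C"
    with sub[OF this] sublinear_minus[of q x] show "- q0 (- x) \<le> q x"
      by (auto simp: le_fun_def) (meson neg_le_iff_le order_trans)
  qed
  have upper: "u x \<le> q x" if "q \<in> C" for q x
    unfolding u_def using that by (intro cINF_lower bdd)
  have greatest: "z \<le> u x" if "\<And>q. q \<in> C \<Longrightarrow> z \<le> q x" for z x
    unfolding u_def using that \<open>C \<noteq> {}\<close> by (intro cINF_greatest)
  show "u \<le> q" if "q \<in> C" for q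
    using upper[OF that] by (simp add: le_fun_def)
  show "sublinear u"
  proof (rule sublinearI)
    fix x y
    have "u (x + y) - p x \<le> q y" if p: "p \<in> C" and q: "q \<in> C" for p q
    proof -
      obtain r where r: "r \<in> C" "r \<le> p" "r \<le> q"
        using chain[OF p q] p q by auto
      have "u (x + y) \<le> r (x + y)" by (rule upper) (rule r)
      also have "\<dots> \<le> r x + r y" using sub[OF r(1)] by (simp add: sublinear_add)
      also have "\<dots> \<le> p x + q y" using r(2,3) by (simp add: le_fun_def add_mono)
      finally show ?thesis by simp
    qed
    then have "u (x + y) - p x \<le> u y" if "p \<in> C" for p
      using that by (intro greatest)
    then have "u (x + y) - u y \<le> u x"
      by (intro greatest) (simp add: algebra_simps)
    then show "u (x + y) \<le> u x + u y" by simp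
  next
    fix c :: real and x assume c: "c > 0"
    have "u (c *\<^sub>R x) / c \<le> u x"
    proof (rule greatest)
      fix q assume q: "q \<in> C"
      show "u (c *\<^sub>R x) / c \<le> q x"
        using upper[OF q, of "c *\<^sub>R x"] sublinear_scale[of q c x] sub[OF q] c
        by (simp add: field_simps)
    qed
    then show "u (c *\<^sub>R x) \<le> c * u x"
      using c by (simp add: field_simps)
  next
    show "u 0 = 0"
      using \<open>C \<noteq> {}\<close> sub by (simp add: u_def sublinear_zero)
  qed
qed

lemma minimal_sublinear_linear:
  fixes q :: "'a::real_vector \<Rightarrow> real"
  assumes q: "sublinear q" and min: "\<And>q'. sublinear q' \<Longrightarrow> q' \<le> q \<Longrightarrow> q' = q"
  shows "linear q"
proof -
  have odd: "q (- y) = - q y" for y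
  proof -
    obtain q' where "sublinear q'" "q' \<le> q" "q' (- y) \<le> - q y"
      using sublinear_tilt[OF q] .
    with min[of q'] have "q (- y) \<le> - q y" by simp
    with sublinear_minus[OF q, of y] show ?thesis by simp
  qed
  show ?thesis
  proof (rule linearI)
    fix x y
    \<comment> \<open>By oddness, subadditivity at \<open>- x\<close> and \<open>- y\<close> becomes
      the reverse inequality.\<close>
    show "q (x + y) = q x + q y"
      using sublinear_add[OF q, of x y] sublinear_add[OF q, of "- x" "- y"] odd[of "x + y"]
      by (simp add: odd)
  next
    fix c x
    show "q (c *\<^sub>R x) = c *\<^sub>R q x"
      using sublinear_scale[OF q, of c x] sublinear_scale[OF q, of "- c" x] odd[of "c *\<^sub>R x"]
      by (cases "c \<ge> 0") auto
  qed
qed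

theorem Hahn_Banach_sublinear:
  fixes q0 :: "'a::real_vector \<Rightarrow> real"
  assumes q0: "sublinear q0"
  obtains \<phi> where "linear \<phi>" "\<phi> \<le> q0"
proof -
  define A where "A = {q. sublinear q \<and> q \<le> q0}"
  have "\<exists>m\<in>A. \<forall>a\<in>A. a \<le> m \<longrightarrow> a = m"
  \<comment> \<open>The order is reversed, so that a maximal element is a minimal
    functional.\<close>
  proof (rule predicate_Zorn[where P = "\<lambda>a b. b \<le> a"])
    show "partial_order_on A (relation_of (\<lambda>a b. b \<le> a) A)"
      by (rule partial_order_on_relation_ofI) auto
    fix C assume C: "C \<in> Chains (relation_of (\<lambda>a b. b \<le> a) A)"
    then have CA: "C \<subseteq> A" by (rule Chains_relation_of)
    show "\<exists>u\<in>A. \<forall>a\<in>C. u \<le> a"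
    proof (cases "C = {}")
      case True
      then show ?thesis using q0 by (auto simp: A_def)
    next
      case False
      have sub: "sublinear q \<and> q \<le> q0" if "q \<in> C" for q
        using CA that by (auto simp: A_def)
      have chain: "p \<le> q \<or> q \<le> p" if "p \<in> C" "q \<in> C" for p q
        using C that by (auto simp: Chains_def relation_of_def)
      obtain u where "sublinear u" and le: "\<And>q. q \<in> C \<Longrightarrow> u \<le> q"
        using sublinear_INF_chain[OF sub chain False] by blast
      moreover from False obtain q where "q \<in> C" by auto
      ultimately have "u \<in> A"
        using sub[of q] le[of q] by (auto simp: A_def intro: order_trans)
      then show ?thesis using le by auto
    qed
  qed
  then obtain q where "q \<in> A" and min: "\<And>a. a \<in> A \<Longrightarrow> a \<le> q \<Longrightarrow> a = q" by auto
  then have q: "sublinear q" "q \<le> q0" by (auto simp: A_def)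
  \<comment> \<open>Minimality in \<open>A\<close> is minimality among all sublinear functionals,
    since whatever lies below \<open>q\<close> also lies below \<open>q0\<close>.\<close>
  have "linear q"
    using q by (intro minimal_sublinear_linear min) (auto simp: A_def)
  with q(2) show ?thesis using that by blast
qed

corollary norming_functional:
  fixes v :: "'a::real_normed_vector"
  obtains \<phi> where "bounded_linear \<phi>" "\<And>x. \<bar>\<phi> x\<bar> \<le> norm x" "norm v \<le> \<phi> v"
proof -
  obtain q0 where q0: "sublinear q0" "q0 \<le> norm" "q0 (- v) \<le> - norm v"
    using sublinear_tilt[OF sublinear_norm] .
  obtain \<phi> where \<phi>: "linear \<phi>" "\<phi> \<le> q0"
    using Hahn_Banach_sublinear[OF q0(1)] .
  have le: "\<phi> x \<le> norm x" for x
    using \<phi>(2) q0(2) by (auto simp: le_fun_def intro: order_trans)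
  have abs: "\<bar>\<phi> x\<bar> \<le> norm x" for x
    using le[of x] le[of "- x"] by (simp add: linear_neg[OF \<phi>(1)] abs_le_iff)
  moreover from \<phi>(1) abs have "bounded_linear \<phi>"
    by (intro bounded_linear_intro[where K = 1])
       (auto simp: linear_add linear_scale)
  moreover have "\<phi> (- v) \<le> - norm v"
    using \<phi>(2) q0(3) by (auto simp: le_fun_def intro: order_trans)
  then have "norm v \<le> \<phi> v"
    by (simp add: linear_neg[OF \<phi>(1)])
  ultimately show ?thesis using that by blast
qed

section \<open>Smoothness of elementary functions\<close>

text \<open>This class is closed under partial derivatives along \<open>\<Phi>\<close>, which makes its members smooth
  without any chain or product rule of higher order.\<close>

inductive_set elementary :: "('a \<Rightarrow> real) set \<Rightarrow> ('a \<Rightarrow> real) set"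
  for \<Phi> :: "('a \<Rightarrow> real) set" where
  const: "(\<lambda>x. c) \<in> elementary \<Phi>"
| base: "\<phi> \<in> \<Phi> \<Longrightarrow> \<phi> \<in> elementary \<Phi>"
| add: "g \<in> elementary \<Phi> \<Longrightarrow> h \<in> elementary \<Phi> \<Longrightarrow> (\<lambda>x. g x + h x) \<in> elementary \<Phi>"
| mult: "g \<in> elementary \<Phi> \<Longrightarrow> h \<in> elementary \<Phi> \<Longrightarrow> (\<lambda>x. g x * h x) \<in> elementary \<Phi>"
| exp: "g \<in> elementary \<Phi> \<Longrightarrow> (\<lambda>x. exp (g x)) \<in> elementary \<Phi>"
| inverse: "g \<in> elementary \<Phi> \<Longrightarrow> (\<And>x. g x \<noteq> 0) \<Longrightarrow> (\<lambda>x. inverse (g x)) \<in> elementary \<Phi>"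
| ln: "g \<in> elementary \<Phi> \<Longrightarrow> (\<And>x. g x > 0) \<Longrightarrow> (\<lambda>x. ln (g x)) \<in> elementary \<Phi>"

lemma elementary_sum:
  assumes "\<And>i. i \<in> I \<Longrightarrow> g i \<in> elementary \<Phi>"
  shows "(\<lambda>x. \<Sum>i\<in>I. g i x) \<in> elementary \<Phi>"
  using assms
  by (induction I rule: infinite_finite_induct)
     (auto intro: elementary.const elementary.add)

lemma elementary_cmult: "g \<in> elementary \<Phi> \<Longrightarrow> (\<lambda>x. c * g x) \<in> elementary \<Phi>"
  by (intro elementary.mult elementary.const)

text \<open>The members of \<open>\<Phi>\<close> may be linearly dependent, so the coefficients
  \<open>d \<phi>\<close> are chosen rather than determined by \<open>g\<close>. Each
  differentiation rule keeps them in the class, which permits iteration.\<close>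

lemma elementary_partials:
  fixes \<Phi> :: "('a::real_normed_vector \<Rightarrow> real) set"
  assumes "g \<in> elementary \<Phi>" "finite \<Phi>" and lin: "\<And>\<phi>. \<phi> \<in> \<Phi> \<Longrightarrow> bounded_linear \<phi>"
  obtains d where "\<And>\<phi>. \<phi> \<in> \<Phi> \<Longrightarrow> d \<phi> \<in> elementary \<Phi>"
    "\<And>x. (g has_derivative (\<lambda>v. \<Sum>\<phi>\<in>\<Phi>. \<phi> v * d \<phi> x)) (at x)"
proof -
  have "\<exists>d. (\<forall>\<phi>\<in>\<Phi>. d \<phi> \<in> elementary \<Phi>) \<and>
    (\<forall>x. (g has_derivative (\<lambda>v. \<Sum>\<phi>\<in>\<Phi>. \<phi> v * d \<phi> x)) (at x))"
    using assms(1)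
  proof induction
    case (const c)
    show ?case
      by (rule exI[of _ "\<lambda>\<phi> x. 0"]) (auto intro: elementary.const)
  next
    case (base \<phi>)
    have eq: "(\<Sum>\<psi>\<in>\<Phi>. \<psi> v * (if \<psi> = \<phi> then 1 else 0)) = \<phi> v" for v
      using base \<open>finite \<Phi>\<close> by (simp add: if_distrib sum.delta cong: if_cong)
    show ?case
      by (rule exI[of _ "\<lambda>\<psi> x. if \<psi> = \<phi> then 1 else 0"])
         (auto simp: eq elementary.const intro!: bounded_linear_imp_has_derivative lin base)
  next
    case (add g h)
    then obtain dg dh where
      d: "\<And>\<phi>. \<phi> \<in> \<Phi> \<Longrightarrow> dg \<phi> \<in> elementary \<Phi>" "\<And>\<phi>. \<phi> \<in> \<Phi> \<Longrightarrow> dh \<phi> \<in> elementary \<Phi>"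
      "\<And>x. (g has_derivative (\<lambda>v. \<Sum>\<phi>\<in>\<Phi>. \<phi> v * dg \<phi> x)) (at x)"
      "\<And>x. (h has_derivative (\<lambda>v. \<Sum>\<phi>\<in>\<Phi>. \<phi> v * dh \<phi> x)) (at x)"
      by blast
    show ?case
    proof (rule exI[of _ "\<lambda>\<phi> x. dg \<phi> x + dh \<phi> x"], intro conjI ballI allI)
      show "((\<lambda>x. g x + h x) has_derivative (\<lambda>v. \<Sum>\<phi>\<in>\<Phi>. \<phi> v * (dg \<phi> x + dh \<phi> x))) (at x)" for x
        by (rule has_derivative_eq_rhs[OF has_derivative_add[OF d(3,4)]])
           (simp add: algebra_simps sum.distrib)
    qed (intro elementary.intros d)
  next
    case (mult g h)
    then obtain dg dh where
      d: "\<And>\<phi>. \<phi> \<in> \<Phi> \<Longrightarrow> dg \<phi> \<in> elementary \<Phi>" "\<And>\<phi>. \<phi> \<in> \<Phi> \<Longrightarrow> dh \<phi> \<in> elementary \<Phi>"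
      "\<And>x. (g has_derivative (\<lambda>v. \<Sum>\<phi>\<in>\<Phi>. \<phi> v * dg \<phi> x)) (at x)"
      "\<And>x. (h has_derivative (\<lambda>v. \<Sum>\<phi>\<in>\<Phi>. \<phi> v * dh \<phi> x)) (at x)"
      by blast
    show ?case
    proof (rule exI[of _ "\<lambda>\<phi> x. g x * dh \<phi> x + dg \<phi> x * h x"], intro conjI ballI allI)
      show "((\<lambda>x. g x * h x) has_derivative
          (\<lambda>v. \<Sum>\<phi>\<in>\<Phi>. \<phi> v * (g x * dh \<phi> x + dg \<phi> x * h x))) (at x)" for x
        by (rule has_derivative_eq_rhs[OF has_derivative_mult[OF d(3,4)]])
           (simp add: algebra_simps sum.distrib sum_distrib_left)
    qed (intro elementary.intros d mult)
  next
    case (exp g)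
    then obtain d where
      d: "\<And>\<phi>. \<phi> \<in> \<Phi> \<Longrightarrow> d \<phi> \<in> elementary \<Phi>"
      "\<And>x. (g has_derivative (\<lambda>v. \<Sum>\<phi>\<in>\<Phi>. \<phi> v * d \<phi> x)) (at x)"
      by blast
    show ?case
    proof (rule exI[of _ "\<lambda>\<phi> x. exp (g x) * d \<phi> x"], intro conjI ballI allI)
      show "((\<lambda>x. exp (g x)) has_derivative (\<lambda>v. \<Sum>\<phi>\<in>\<Phi>. \<phi> v * (exp (g x) * d \<phi> x))) (at x)" for x
        by (rule has_derivative_eq_rhs[OF has_derivative_exp[OF d(2)]])
           (simp add: algebra_simps sum_distrib_left)
    qed (intro elementary.intros d exp)
  next
    case (inverse g)
    then obtain d where
      d: "\<And>\<phi>. \<phi> \<in> \<Phi> \<Longrightarrow> d \<phi> \<in> elementary \<Phi>"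
      "\<And>x. (g has_derivative (\<lambda>v. \<Sum>\<phi>\<in>\<Phi>. \<phi> v * d \<phi> x)) (at x)"
      by blast
    show ?case
    proof (rule exI[of _ "\<lambda>\<phi> x. (-1) * (inverse (g x) * inverse (g x) * d \<phi> x)"], intro conjI ballI allI)
      show "((\<lambda>x. inverse (g x)) has_derivative
          (\<lambda>v. \<Sum>\<phi>\<in>\<Phi>. \<phi> v * ((-1) * (inverse (g x) * inverse (g x) * d \<phi> x)))) (at x)" for x
        by (rule has_derivative_eq_rhs[OF Deriv.has_derivative_inverse[OF inverse.hyps(2) d(2)]])
           (simp add: algebra_simps sum_distrib_left sum_negf)
    qed (intro elementary.intros d inverse)
  next
    case (ln g)
    then obtain d where
      d: "\<And>\<phi>. \<phi> \<in> \<Phi> \<Longrightarrow> d \<phi> \<in> elementary \<Phi>"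
      "\<And>x. (g has_derivative (\<lambda>v. \<Sum>\<phi>\<in>\<Phi>. \<phi> v * d \<phi> x)) (at x)"
      by blast
    have nz: "g x \<noteq> 0" for x using ln.hyps(2)[of x] by simp
    show ?case
    proof (rule exI[of _ "\<lambda>\<phi> x. inverse (g x) * d \<phi> x"], intro conjI ballI allI)
      show "((\<lambda>x. ln (g x)) has_derivative (\<lambda>v. \<Sum>\<phi>\<in>\<Phi>. \<phi> v * (inverse (g x) * d \<phi> x))) (at x)" for x
        by (rule has_derivative_eq_rhs[OF has_derivative_ln[OF ln.hyps(2) d(2)]])
           (simp add: algebra_simps sum_distrib_left)
    qed (intro elementary.intros d ln nz)
  qed
  then show ?thesis using that by blast
qed

section \<open>Iterated derivatives as multilinear forms\<close>

text \<open>Isolates the only factor that contains \<open>u\<close>, so that linearity in slot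
  \<open>i\<close> reduces to linearity of \<open>J ! i\<close>.\<close>

lemma prod_list_map2_update:
  fixes J :: "('a \<Rightarrow> real) list"
  assumes "length vs = length J" "i < length vs"
  shows "prod_list (map2 (\<lambda>\<phi> v. \<phi> v) J (vs[i := u])) =
    (J ! i) u * prod_list (map2 (\<lambda>\<phi> v. \<phi> v) (take i J @ drop (Suc i) J) (take i vs @ drop (Suc i) vs))"
proof -
  have J: "J = take i J @ J ! i # drop (Suc i) J"
    using assms by (simp add: id_take_nth_drop)
  have vs: "vs[i := u] = take i vs @ u # drop (Suc i) vs"
    using assms by (simp add: upd_conv_take_nth_drop)
  show ?thesis
    using assms by (subst J, subst vs) (simp add: algebra_simps)
qed

lemma abs_prod_list_map2_le:
  assumes "length vs = length J" "\<And>\<phi> v. \<phi> \<in> set J \<Longrightarrow> \<bar>\<phi> v\<bar> \<le> K * norm (v::'a::real_normed_vector)" "K \<ge> 0"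
  shows "\<bar>prod_list (map2 (\<lambda>\<phi> v. \<phi> v) J vs)\<bar> \<le> K ^ length vs * (\<Prod>v\<leftarrow>vs. norm v)"
  using assms
proof (induction vs J rule: list_induct2)
  case (Cons v vs \<phi> J)
  have "\<bar>\<phi> v\<bar> * \<bar>prod_list (map2 (\<lambda>\<phi> v. \<phi> v) J vs)\<bar>
      \<le> (K * norm v) * (K ^ length vs * (\<Prod>v\<leftarrow>vs. norm v))"
    using Cons by (intro mult_mono) auto
  then show ?case by (simp add: abs_mult algebra_simps)
qed auto

text \<open>The \<open>k\<close>-th derivative is a finite sum over lists \<open>J\<close> of
  \<open>k\<close> functionals: a product of functionals of the directions times a coefficient
  depending only on the point. Differentiating once more therefore only concerns scalar functions of
  the class.\<close>

lemma elementary_smooth_on: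
  fixes \<Phi> :: "('a::real_normed_vector \<Rightarrow> real) set"
  assumes g: "g \<in> elementary \<Phi>" and fin: "finite \<Phi>"
    and lin: "\<And>\<phi>. \<phi> \<in> \<Phi> \<Longrightarrow> bounded_linear \<phi>"
  shows "smooth_on V g"
proof -
  have "\<forall>g\<in>elementary \<Phi>. \<exists>d. (\<forall>\<phi>\<in>\<Phi>. d \<phi> \<in> elementary \<Phi>) \<and>
    (\<forall>x. (g has_derivative (\<lambda>v. \<Sum>\<phi>\<in>\<Phi>. \<phi> v * d \<phi> x)) (at x))"
  proof
    fix g assume "g \<in> elementary \<Phi>"
    then obtain d where "\<And>\<phi>. \<phi> \<in> \<Phi> \<Longrightarrow> d \<phi> \<in> elementary \<Phi>"
      "\<And>x. (g has_derivative (\<lambda>v. \<Sum>\<phi>\<in>\<Phi>. \<phi> v * d \<phi> x)) (at x)"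
      using elementary_partials fin lin by blast
    then show "\<exists>d. (\<forall>\<phi>\<in>\<Phi>. d \<phi> \<in> elementary \<Phi>) \<and>
      (\<forall>x. (g has_derivative (\<lambda>v. \<Sum>\<phi>\<in>\<Phi>. \<phi> v * d \<phi> x)) (at x))"
      by (intro exI[of _ d]) simp
  qed
  \<comment> \<open>Choosing coefficients for the whole class at once turns differentiation into an
    operation that can be iterated.\<close>
  from bchoice[OF this] obtain d where
    d_in: "\<And>g \<phi>. g \<in> elementary \<Phi> \<Longrightarrow> \<phi> \<in> \<Phi> \<Longrightarrow> d g \<phi> \<in> elementary \<Phi>" and
    d: "\<And>g x. g \<in> elementary \<Phi> \<Longrightarrow> (g has_derivative (\<lambda>v. \<Sum>\<phi>\<in>\<Phi>. \<phi> v * d g \<phi> x)) (at x)"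
    by blast
  \<comment> \<open>The newest direction is differentiated last, so that no symmetry of mixed partial derivatives
    is needed below.\<close>
  define pd where "pd J = foldr (\<lambda>\<phi> h. d h \<phi>) J g" for J
  have pd_simps: "pd [] = g" "pd (\<phi> # J) = d (pd J) \<phi>" for \<phi> J
    by (simp_all add: pd_def)
  have pd_in: "pd J \<in> elementary \<Phi>" if "set J \<subseteq> \<Phi>" for J
    using that by (induction J) (auto simp: pd_simps g d_in)
  define L where "L k = {J. set J \<subseteq> \<Phi> \<and> length J = k}" for k
  have finL: "finite (L k)" for k
    unfolding L_def using fin by (rule finite_lists_length_eq)
  define M where "M J vs = prod_list (map2 (\<lambda>\<phi> v. \<phi> v) J vs)" 
    for J :: "('a \<Rightarrow> real) list" and vs :: "'a list"
  define D where "D k x vs = (\<Sum>J\<in>L k. M J vs * pd J x)" for k x vs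
  have "\<exists>B. \<forall>v. \<bar>\<phi> v\<bar> \<le> B * norm v" if "\<phi> \<in> \<Phi>" for \<phi>
    using bounded_linear.bounded[OF lin[OF that]] by (auto simp: mult.commute)
  then have "\<forall>\<phi>\<in>\<Phi>. \<exists>B. \<forall>v. \<bar>\<phi> v\<bar> \<le> B * norm v" by blast
  from bchoice[OF this] obtain B where
    B: "\<And>\<phi> v. \<phi> \<in> \<Phi> \<Longrightarrow> \<bar>\<phi> v\<bar> \<le> B \<phi> * norm v" by blast
  define K where "K = (\<Sum>\<phi>\<in>\<Phi>. \<bar>B \<phi>\<bar>)"
  have K0: "K \<ge> 0" by (simp add: K_def sum_nonneg)
  have K: "\<bar>\<phi> v\<bar> \<le> K * norm v" if "\<phi> \<in> \<Phi>" for \<phi> v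
  proof -
    have "B \<phi> \<le> K"
      using member_le_sum[OF that, of "\<lambda>\<phi>. \<bar>B \<phi>\<bar>"] fin by (simp add: K_def)
    then show ?thesis
      using B[OF that, of v] mult_right_mono[of "B \<phi>" K "norm v"] by simp
  qed
  have M_bound: "\<bar>M J vs\<bar> \<le> K ^ k * (\<Prod>v\<leftarrow>vs. norm v)" if "J \<in> L k" "length vs = k" for J k vs
    unfolding M_def using that K K0 abs_prod_list_map2_le[of vs J K] by (auto simp: L_def subset_iff)
  have prod_nonneg: "(\<Prod>v\<leftarrow>vs. norm v) \<ge> 0" for vs :: "'a list"
    by (induction vs) auto
  have "bounded_multilinear_form V k (D k x)" for k x
    unfolding bounded_multilinear_form_def
  proof (intro conjI ballI impI allI)
    fix vs :: "'a list" and i assume vs: "length vs = k" "i < k"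
    have M_upd: "\<exists>c. \<forall>u. M J (vs[i := u]) = (J ! i) u * c" if "J \<in> L k" for J
      using that vs prod_list_map2_update[of vs J i] by (auto simp: L_def M_def)
    have lin_nth: "bounded_linear (J ! i)" if "J \<in> L k" for J
      using that vs by (intro lin) (auto simp: L_def)
    have M_add: "M J (vs[i := u + w]) = M J (vs[i := u]) + M J (vs[i := w])" if "J \<in> L k" for J u w
      using M_upd[OF that] linear_simps(1)[OF lin_nth[OF that]] by (metis distrib_right)
    have M_scale: "M J (vs[i := c *\<^sub>R u]) = c * M J (vs[i := u])" if "J \<in> L k" for J c u
      using M_upd[OF that] linear_simps(5)[OF lin_nth[OF that]] by (metis mult.assoc real_scaleR_def)
    show "D k x (vs[i := u + w]) = D k x (vs[i := u]) + D k x (vs[i := w])" for u w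
      by (simp add: D_def M_add algebra_simps sum.distrib)
    show "D k x (vs[i := c *\<^sub>R u]) = c * D k x (vs[i := u])" for c u
      by (simp add: D_def M_scale algebra_simps sum_distrib_left)
  next
    have "\<bar>D k x vs\<bar> \<le> (\<Sum>J\<in>L k. K ^ k * \<bar>pd J x\<bar>) * (\<Prod>v\<leftarrow>vs. norm v)" if "length vs = k" for vs :: "'a list"
    proof -
      have "\<bar>D k x vs\<bar> \<le> (\<Sum>J\<in>L k. \<bar>M J vs\<bar> * \<bar>pd J x\<bar>)"
        unfolding D_def by (rule order_trans[OF sum_abs]) (simp add: abs_mult)
      also have "\<dots> \<le> (\<Sum>J\<in>L k. (K ^ k * (\<Prod>v\<leftarrow>vs. norm v)) * \<bar>pd J x\<bar>)"
        using that by (intro sum_mono mult_right_mono M_bound) auto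
      finally show ?thesis by (simp add: sum_distrib_right sum_distrib_left algebra_simps)
    qed
    then show "\<exists>C. \<forall>vs\<in>lists V. length vs = k \<longrightarrow> \<bar>D k x vs\<bar> \<le> C * (\<Prod>v\<leftarrow>vs. norm v)"
      by blast
  qed
  moreover have "\<forall>\<^sub>F y in at x within V.
       \<forall>vs\<in>lists V. length vs = k \<longrightarrow>
         \<bar>D k y vs - D k x vs - D (Suc k) x ((y - x) # vs)\<bar> \<le> e * norm (y - x) * (\<Prod>v\<leftarrow>vs. norm v)"
    if e: "e > 0" for k x e
  proof -
    \<comment> \<open>The first-order remainder of a coefficient. It does not involve
      \<open>vs\<close>, which makes the final estimate uniform in the directions.\<close>
    define R where "R J y = pd J y - pd J x - (\<Sum>\<phi>\<in>\<Phi>. \<phi> (y - x) * pd (\<phi> # J) x)" for J y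
    \<comment> \<open>The summand \<open>1\<close> keeps the divisor positive when the product
      vanishes.\<close>
    define N where "N = K ^ k * real (card (L k)) + 1"
    have N: "N > 0" unfolding N_def using K0 by (simp add: add_nonneg_pos)
    have D_Suc: "D (Suc k) x (w # vs) = (\<Sum>J\<in>L k. M J vs * (\<Sum>\<phi>\<in>\<Phi>. \<phi> w * pd (\<phi> # J) x))"
      for w and vs :: "'a list"
    proof -
      have L_Suc: "L (Suc k) = (\<lambda>(J, \<phi>). \<phi> # J) ` (L k \<times> \<Phi>)"
        by (auto simp: L_def image_iff length_Suc_conv)
      have "inj_on (\<lambda>(J, \<phi>). \<phi> # J) (L k \<times> \<Phi>)"
        by (auto simp: inj_on_def)
      then have "D (Suc k) x (w # vs) = (\<Sum>(J, \<phi>)\<in>L k \<times> \<Phi>. M (\<phi> # J) (w # vs) * pd (\<phi> # J) x)"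
        unfolding D_def L_Suc by (simp add: sum.reindex case_prod_unfold)
      also have "\<dots> = (\<Sum>J\<in>L k. \<Sum>\<phi>\<in>\<Phi>. M (\<phi> # J) (w # vs) * pd (\<phi> # J) x)"
        by (simp add: sum.cartesian_product)
      finally show ?thesis
        by (simp add: M_def sum_distrib_left algebra_simps)
    qed
    have diff: "D k y vs - D k x vs - D (Suc k) x ((y - x) # vs) = (\<Sum>J\<in>L k. M J vs * R J y)" for y vs
      unfolding D_Suc by (simp add: D_def R_def algebra_simps sum_subtractf sum.distrib)
    have "\<forall>\<^sub>F y in at x. \<bar>R J y\<bar> \<le> e / N * norm (y - x)" if "J \<in> L k" for J
    proof -
      have "(pd J has_derivative (\<lambda>v. \<Sum>\<phi>\<in>\<Phi>. \<phi> v * pd (\<phi> # J) x)) (at x within UNIV)"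
        using d[OF pd_in, of J x] that by (simp add: L_def pd_simps)
      then have "\<exists>r>0. \<forall>y\<in>UNIV. norm (y - x) < r \<longrightarrow> \<bar>R J y\<bar> \<le> e / N * norm (y - x)"
        unfolding has_derivative_within_alt R_def using divide_pos_pos[OF e N]
        by (simp only: real_norm_def)
      then show ?thesis
        by (auto simp: eventually_at dist_norm)
    qed
    then have "\<forall>\<^sub>F y in at x. \<forall>J\<in>L k. \<bar>R J y\<bar> \<le> e / N * norm (y - x)"
      by (intro eventually_ball_finite finL) blast
    then have "\<forall>\<^sub>F y in at x within V. \<forall>J\<in>L k. \<bar>R J y\<bar> \<le> e / N * norm (y - x)"
      using at_le[of V UNIV x] by (auto intro: filter_leD)
    then show ?thesis
    proof eventually_elim
      case (elim y)
      show ?case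
      proof (intro ballI impI)
        fix vs :: "'a list" assume vs: "length vs = k"
        have "\<bar>\<Sum>J\<in>L k. M J vs * R J y\<bar> \<le> (\<Sum>J\<in>L k. \<bar>M J vs\<bar> * \<bar>R J y\<bar>)"
          by (rule order_trans[OF sum_abs]) (simp add: abs_mult)
        also have "\<dots> \<le> (\<Sum>J\<in>L k. (K ^ k * (\<Prod>v\<leftarrow>vs. norm v)) * (e / N * norm (y - x)))"
          using elim vs by (intro sum_mono mult_mono M_bound mult_nonneg_nonneg) (auto simp: K0 prod_nonneg)
        also have "\<dots> = (K ^ k * real (card (L k)) / N) * (e * norm (y - x) * (\<Prod>v\<leftarrow>vs. norm v))"
          by simp
        also have "\<dots> \<le> 1 * (e * norm (y - x) * (\<Prod>v\<leftarrow>vs. norm v))"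
          using N e by (intro mult_right_mono mult_nonneg_nonneg prod_nonneg) (auto simp: N_def)
        finally show "\<bar>D k y vs - D k x vs - D (Suc k) x ((y - x) # vs)\<bar>
            \<le> e * norm (y - x) * (\<Prod>v\<leftarrow>vs. norm v)"
          by (simp add: diff)
      qed
    qed
  qed
  moreover have "D 0 x [] = g x" for x
  proof -
    have "L 0 = {[]}" by (auto simp: L_def)
    then show ?thesis by (simp add: D_def M_def pd_simps)
  qed
  ultimately show ?thesis
    unfolding smooth_on_def by (intro exI[of _ D]) blast
qed

section \<open>Smoothed minima of maxima\<close>

text \<open>\<open>F\<close> is a smooth version of \<open>min M (Min t\<in>S. max m (Max i\<in>I. \<alpha> t i))\<close>, obtained from
  log-sum-exp with the same parameter \<open>\<theta>\<close> for minima and maxima, so that the inner logarithms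
  cancel against the outer exponentials. Its gradient is the sum of the gradients of the \<open>\<alpha> t i\<close>
  with the weights \<open>W\<close>.\<close>

locale soft_min_max =
  fixes S :: "'t set" and I :: "'i set"
    and l :: "'i \<Rightarrow> 'a::real_normed_vector \<Rightarrow> real"
    and \<sigma> \<beta> :: "'t \<Rightarrow> 'i \<Rightarrow> real" and \<theta> m M :: real
  assumes finite_S: "finite S" and finite_I: "finite I"
    and bounded_linear_l: "i \<in> I \<Longrightarrow> bounded_linear (l i)"
    and l_le: "i \<in> I \<Longrightarrow> \<bar>l i v\<bar> \<le> norm v"
    and \<sigma>_nonneg: "t \<in> S \<Longrightarrow> i \<in> I \<Longrightarrow> \<sigma> t i \<ge> 0"
    and \<theta>_pos: "\<theta> > 0"
begin

definition \<alpha> :: "'t \<Rightarrow> 'i \<Rightarrow> 'a \<Rightarrow> real" where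
  "\<alpha> t i x = \<sigma> t i * l i x + \<beta> t i"

text \<open>\<open>ln (Z t x) / \<theta>\<close> is the soft maximum of \<open>m\<close> and the
  \<open>\<alpha> t i x\<close>.\<close>

definition Z :: "'t \<Rightarrow> 'a \<Rightarrow> real" where
  "Z t x = exp (\<theta> * m) + (\<Sum>i\<in>I. exp (\<theta> * \<alpha> t i x))"

definition Q :: "'a \<Rightarrow> real" where
  "Q x = exp (- (\<theta> * M)) + (\<Sum>t\<in>S. inverse (Z t x))"

definition F :: "'a \<Rightarrow> real" where
  "F x = (- 1 / \<theta>) * ln (Q x)"

text \<open>A product of two softmax weights: that of \<open>i\<close> in the maximum of branch
  \<open>t\<close>, and that of \<open>t\<close> in the minimum.\<close>

definition W :: "'a \<Rightarrow> 't \<Rightarrow> 'i \<Rightarrow> real" where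
  "W x t i = exp (\<theta> * \<alpha> t i x) / Z t x * (inverse (Z t x) / Q x)"

lemma Z_pos: "Z t x > 0"
  unfolding Z_def by (intro add_pos_nonneg sum_nonneg) auto

lemma Q_pos: "Q x > 0"
  unfolding Q_def using Z_pos by (intro add_pos_nonneg sum_nonneg) (auto intro: less_imp_le)

lemma Z_ge_m: "exp (\<theta> * m) \<le> Z t x"
  unfolding Z_def by (simp add: sum_nonneg)

lemma Z_ge: "i \<in> I \<Longrightarrow> exp (\<theta> * \<alpha> t i x) \<le> Z t x"
  unfolding Z_def using finite_I member_le_sum[of i I "\<lambda>i. exp (\<theta> * \<alpha> t i x)"]
  by (simp add: add_increasing)

lemma Q_ge_M: "exp (- (\<theta> * M)) \<le> Q x"
  unfolding Q_def using Z_pos by (simp add: sum_nonneg less_imp_le)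

lemma Q_ge: "t \<in> S \<Longrightarrow> inverse (Z t x) \<le> Q x"
  unfolding Q_def using finite_S Z_pos member_le_sum[of t S "\<lambda>t. inverse (Z t x)"]
  by (simp add: add_increasing less_imp_le)

lemma F_elementary: "F \<in> elementary (l ` I)"
proof -
  have "\<alpha> t i \<in> elementary (l ` I)" if "i \<in> I" for t i
    unfolding \<alpha>_def using that
    by (intro elementary.add elementary_cmult elementary.base elementary.const) auto
  then have "Z t \<in> elementary (l ` I)" for t
    unfolding Z_def
    by (intro elementary.add elementary_sum elementary.exp elementary_cmult elementary.const) auto
  moreover have "Z t x \<noteq> 0" for t x using Z_pos[of t x] by simp
  ultimately have "Q \<in> elementary (l ` I)"
    unfolding Q_def by (intro elementary.add elementary_sum elementary.inverse elementary.const) auto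
  then show ?thesis
    unfolding F_def by (intro elementary_cmult elementary.ln Q_pos)
qed

text \<open>\<open>elementary_partials\<close> does not control the size of its coefficients, so the
  gradient is computed explicitly. The sign from the inverse and the factor \<open>\<theta>\<close>
  cancel against \<open>- 1 / \<theta>\<close>.\<close>

lemma F_has_derivative:
  "(F has_derivative (\<lambda>v. \<Sum>t\<in>S. \<Sum>i\<in>I. W x t i * (\<sigma> t i * l i v))) (at x)"
proof -
  have der_\<alpha>: "(\<alpha> t i has_derivative (\<lambda>v. \<sigma> t i * l i v)) (at x)" if "i \<in> I" for t i
    unfolding \<alpha>_def using bounded_linear_imp_has_derivative[OF bounded_linear_l[OF that]]
    by (auto intro!: derivative_eq_intros)
  have der_Z: "(Z t has_derivative (\<lambda>v. \<Sum>i\<in>I. exp (\<theta> * \<alpha> t i x) * (\<theta> * (\<sigma> t i * l i v)))) (at x)" for t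
    unfolding Z_def
    by (rule has_derivative_eq_rhs,
        rule has_derivative_add[OF has_derivative_const has_derivative_sum],
        rule has_derivative_exp, rule has_derivative_mult_right, erule der_\<alpha>) (simp add: ac_simps)
  have nz: "Z t x \<noteq> 0" for t using Z_pos[of t x] by simp
  have "(Q has_derivative (\<lambda>v. \<Sum>t\<in>S. - (inverse (Z t x) *
      (\<Sum>i\<in>I. exp (\<theta> * \<alpha> t i x) * (\<theta> * (\<sigma> t i * l i v))) * inverse (Z t x)))) (at x)"
    unfolding Q_def
    by (rule has_derivative_eq_rhs,
        rule has_derivative_add[OF has_derivative_const has_derivative_sum],
        rule Deriv.has_derivative_inverse[OF nz der_Z]) simp
  from has_derivative_mult_right[OF has_derivative_ln[OF Q_pos this], of "- 1 / \<theta>"]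
  show ?thesis
    unfolding F_def
  proof (rule has_derivative_eq_rhs, intro ext)
    fix v
    have "- 1 / \<theta> * ((\<Sum>t\<in>S. - (inverse (Z t x) * (\<Sum>i\<in>I. exp (\<theta> * \<alpha> t i x) *
            (\<theta> * (\<sigma> t i * l i v))) * inverse (Z t x))) * inverse (Q x))
        = (\<Sum>t\<in>S. \<Sum>i\<in>I. (- 1 / \<theta>) * (- (inverse (Z t x) * (exp (\<theta> * \<alpha> t i x) *
            (\<theta> * (\<sigma> t i * l i v))) * inverse (Z t x)) * inverse (Q x)))"
      by (simp only: sum_distrib_left sum_distrib_right sum_negf[symmetric])
    also have "\<dots> = (\<Sum>t\<in>S. \<Sum>i\<in>I. W x t i * (\<sigma> t i * l i v))"
      using \<theta>_pos by (intro sum.cong refl) (simp add: W_def field_simps)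
    finally show "- 1 / \<theta> * ((\<Sum>t\<in>S. - (inverse (Z t x) * (\<Sum>i\<in>I. exp (\<theta> * \<alpha> t i x) *
            (\<theta> * (\<sigma> t i * l i v))) * inverse (Z t x))) * inverse (Q x))
        = (\<Sum>t\<in>S. \<Sum>i\<in>I. W x t i * (\<sigma> t i * l i v))" .
  qed
qed

section \<open>Weights and the gradient bound\<close>

lemma W_nonneg: "W x t i \<ge> 0"
  unfolding W_def using Z_pos[of t x] Q_pos[of x] by simp

text \<open>Both factors of \<open>W\<close> come from normalised sums; the terms of
  \<open>m\<close> and \<open>M\<close> carry the missing weight.\<close>

lemma sum_W_le: "(\<Sum>t\<in>S. \<Sum>i\<in>I. W x t i) \<le> 1"
proof -
  have "(\<Sum>i\<in>I. W x t i) \<le> inverse (Z t x) / Q x" for t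
  proof -
    have "(\<Sum>i\<in>I. exp (\<theta> * \<alpha> t i x)) / Z t x \<le> 1"
      using Z_pos[of t x] by (simp add: Z_def)
    then have "(\<Sum>i\<in>I. exp (\<theta> * \<alpha> t i x)) / Z t x * (inverse (Z t x) / Q x) \<le> 1 * (inverse (Z t x) / Q x)"
      using Z_pos[of t x] Q_pos[of x] by (intro mult_right_mono) auto
    then show ?thesis
      by (simp add: W_def sum_distrib_right sum_divide_distrib)
  qed
  then have "(\<Sum>t\<in>S. \<Sum>i\<in>I. W x t i) \<le> (\<Sum>t\<in>S. inverse (Z t x) / Q x)"
    by (rule sum_mono)
  also have "\<dots> = (\<Sum>t\<in>S. inverse (Z t x)) / Q x"
    by (simp add: sum_divide_distrib)
  also have "\<dots> \<le> 1"
    using Q_pos[of x] by (simp add: Q_def)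
  finally show ?thesis .
qed

text \<open>Serves for a piece dominated by another piece of the same branch.\<close>

lemma W_le_branch:
  assumes "t \<in> S"
  shows "W x t i \<le> exp (\<theta> * \<alpha> t i x) / Z t x"
proof -
  have "inverse (Z t x) / Q x \<le> 1"
    using Q_ge[OF assms, of x] Q_pos[of x] by simp
  then show ?thesis
    unfolding W_def using Z_pos[of t x] by (intro mult_left_le) auto
qed

text \<open>Serves for a branch \<open>t\<close> lying far above another branch \<open>s\<close>,
  which hence has little weight in the minimum.\<close>

lemma W_le_ratio:
  assumes "i \<in> I" "s \<in> S"
  shows "W x t i \<le> Z s x / Z t x"
proof -
  have "inverse (Q x) \<le> Z s x"
    using Q_ge[OF assms(2), of x] Z_pos[of s x] le_imp_inverse_le[of "inverse (Z s x)" "Q x"] by simp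
  then have "inverse (Z t x) / Q x \<le> Z s x / Z t x"
    using Z_pos[of t x] by (simp add: field_simps)
  moreover have "exp (\<theta> * \<alpha> t i x) / Z t x \<le> 1"
    using Z_ge[OF assms(1), of t x] Z_pos[of t x] by simp
  ultimately have "exp (\<theta> * \<alpha> t i x) / Z t x * (inverse (Z t x) / Q x) \<le> 1 * (Z s x / Z t x)"
    using Z_pos[of t x] Q_pos[of x] by (intro mult_mono) auto
  then show ?thesis by (simp add: W_def)
qed

text \<open>Slopes up to \<open>C\<close> contribute at most \<open>C\<close> in total, as the
  weights sum to at most \<open>1\<close>; every other pair contributes at most
  \<open>\<Lambda> * \<omega>\<close>.\<close>

lemma derivative_bound:
  assumes "C \<ge> 0" "\<omega> \<ge> 0" "\<Lambda> \<ge> 0"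
    and "\<And>t i. t \<in> S \<Longrightarrow> i \<in> I \<Longrightarrow> \<sigma> t i \<le> \<Lambda>"
    and bad: "\<And>t i. t \<in> S \<Longrightarrow> i \<in> I \<Longrightarrow> \<sigma> t i \<le> C \<or> W x t i \<le> \<omega>"
  shows "\<bar>\<Sum>t\<in>S. \<Sum>i\<in>I. W x t i * (\<sigma> t i * l i v)\<bar>
    \<le> (C + \<Lambda> * (real (card S) * real (card I) * \<omega>)) * norm v"
proof -
  have "\<bar>\<Sum>t\<in>S. \<Sum>i\<in>I. W x t i * (\<sigma> t i * l i v)\<bar> \<le> (\<Sum>t\<in>S. \<Sum>i\<in>I. \<bar>W x t i * (\<sigma> t i * l i v)\<bar>)"
    by (intro order_trans[OF sum_abs] sum_mono) simp
  also have "\<dots> \<le> (\<Sum>t\<in>S. \<Sum>i\<in>I. (C * W x t i + \<Lambda> * \<omega>) * norm v)"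
  proof (intro sum_mono)
    fix t i assume ti: "t \<in> S" "i \<in> I"
    have "W x t i * \<sigma> t i \<le> C * W x t i + \<Lambda> * \<omega>"
    proof (cases "\<sigma> t i \<le> C")
      case True
      then have "W x t i * \<sigma> t i \<le> W x t i * C"
        by (intro mult_left_mono W_nonneg)
      then show ?thesis using assms(2,3) by (simp add: mult.commute add_increasing2)
    next
      case False
      with bad[OF ti] have "W x t i * \<sigma> t i \<le> \<omega> * \<Lambda>"
        using assms ti by (intro mult_mono \<sigma>_nonneg) auto
      then show ?thesis using assms(1) W_nonneg[of x t i] by (simp add: mult.commute add_increasing)
    qed
    then have "W x t i * \<sigma> t i * \<bar>l i v\<bar> \<le> (C * W x t i + \<Lambda> * \<omega>) * norm v"
      using W_nonneg[of x t i] assms(1-3) l_le[OF ti(2)] \<sigma>_nonneg[OF ti] by (intro mult_mono) auto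
    then show "\<bar>W x t i * (\<sigma> t i * l i v)\<bar> \<le> (C * W x t i + \<Lambda> * \<omega>) * norm v"
      using W_nonneg[of x t i] \<sigma>_nonneg[OF ti] by (simp add: abs_mult mult.assoc)
  qed
  also have "\<dots> = (C * (\<Sum>t\<in>S. \<Sum>i\<in>I. W x t i) + \<Lambda> * (real (card S) * real (card I) * \<omega>)) * norm v"
    by (simp add: sum_distrib_left[symmetric] sum_distrib_right[symmetric] sum.distrib)
  also have "\<dots> \<le> (C * 1 + \<Lambda> * (real (card S) * real (card I) * \<omega>)) * norm v"
    using assms(1) sum_W_le by (intro mult_right_mono add_right_mono mult_left_mono) auto
  finally show ?thesis by simp
qed

section \<open>Accuracy of the soft minimum\<close>

lemma F_le_M: "F x \<le> M"
proof -
  have "ln (exp (- (\<theta> * M))) \<le> ln (Q x)"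
    using Q_ge_M[of x] Q_pos[of x] by (subst ln_le_cancel_iff) auto
  then show ?thesis
    using \<theta>_pos by (simp add: F_def field_simps)
qed

text \<open>The error counts the terms of \<open>Q\<close>: one for each branch and one for
  \<open>M\<close>.\<close>

lemma F_ge:
  assumes "\<And>t. t \<in> S \<Longrightarrow> exp (\<theta> * c) \<le> Z t x" "c \<le> M"
  shows "c - ln (1 + real (card S)) / \<theta> \<le> F x"
proof -
  have "inverse (Z t x) \<le> exp (- (\<theta> * c))" if "t \<in> S" for t
    using le_imp_inverse_le[OF assms(1)[OF that]] by (simp add: exp_minus)
  then have "(\<Sum>t\<in>S. inverse (Z t x)) \<le> real (card S) * exp (- (\<theta> * c))"
    by (rule sum_bounded_above)
  moreover have "exp (- (\<theta> * M)) \<le> exp (- (\<theta> * c))"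
    using assms(2) \<theta>_pos by simp
  ultimately have "Q x \<le> (1 + real (card S)) * exp (- (\<theta> * c))"
    unfolding Q_def distrib_right mult_1_left by (rule add_mono[rotated])
  then have "ln (Q x) \<le> ln ((1 + real (card S)) * exp (- (\<theta> * c)))"
    using Q_pos[of x] by (subst ln_le_cancel_iff) (auto intro!: mult_pos_pos)
  also have "\<dots> = ln (1 + real (card S)) - \<theta> * c"
    by (subst ln_mult_pos) auto
  finally have "(\<theta> * c - ln (1 + real (card S))) / \<theta> \<le> - ln (Q x) / \<theta>"
    using \<theta>_pos by (intro divide_right_mono) auto
  then show ?thesis
    using \<theta>_pos by (simp add: F_def diff_divide_distrib)
qed

text \<open>One low branch suffices, because a soft minimum lies below each of its entries.\<close>

lemma F_le:
  assumes "s \<in> S" "Z s x \<le> N * exp (\<theta> * c)" "N > 0"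
  shows "F x \<le> c + ln N / \<theta>"
proof -
  have "inverse (N * exp (\<theta> * c)) \<le> inverse (Z s x)"
    using assms(2) Z_pos by (intro le_imp_inverse_le)
  also have "\<dots> \<le> Q x" using assms(1) by (rule Q_ge)
  finally have "ln (inverse (N * exp (\<theta> * c))) \<le> ln (Q x)"
    using Q_pos[of x] assms(3) by (subst ln_le_cancel_iff) auto
  then have "- (ln N + \<theta> * c) \<le> ln (Q x)"
    using assms(3) by (simp add: ln_inverse ln_mult_pos)
  then show ?thesis
    using \<theta>_pos by (simp add: F_def field_simps)
qed

end

section \<open>Lipschitz constants, cylindrical coordinates and cones\<close>

lemma Lip_le: "L-lipschitz_on A f \<Longrightarrow> Lip f A \<le> L"
  unfolding Lip_def by (rule cInf_lower) (auto intro!: bdd_belowI[of _ 0] lipschitz_on_nonneg)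

text \<open>The infimum is attained: each difference quotient is a lower bound of the admissible
  constants.\<close>

lemma lipschitz_on_Lip:
  assumes "L-lipschitz_on A f"
  shows "(Lip f A)-lipschitz_on A f"
proof (rule lipschitz_onI)
  have ne: "{L. L-lipschitz_on A f} \<noteq> {}" using assms by auto
  show "0 \<le> Lip f A"
    unfolding Lip_def by (rule cInf_greatest[OF ne]) (auto intro: lipschitz_on_nonneg)
  fix x y assume xy: "x \<in> A" "y \<in> A"
  show "dist (f x) (f y) \<le> Lip f A * dist x y"
  proof (cases "x = y")
    case False
    have "dist (f x) (f y) / dist x y \<le> Lip f A"
      unfolding Lip_def
    proof (rule cInf_greatest[OF ne])
      fix K assume "K \<in> {L. L-lipschitz_on A f}"
      then show "dist (f x) (f y) / dist x y \<le> K"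
        using lipschitz_onD[of K A f x y] xy False by (simp add: field_simps)
    qed
    then show ?thesis using False by (simp add: field_simps)
  qed simp
qed

lemma Lip_mono:
  assumes "L-lipschitz_on B f" "A \<subseteq> B"
  shows "Lip f A \<le> Lip f B"
  by (rule Lip_le, rule lipschitz_on_subset[OF lipschitz_on_Lip[OF assms(1)] assms(2)])

lemma lipschitz_on_derivative_bound:
  fixes g :: "'a::real_normed_vector \<Rightarrow> real"
  assumes "\<And>x. (g has_derivative g' x) (at x)" "\<And>x v. \<bar>g' x v\<bar> \<le> L * norm v" "L \<ge> 0"
  shows "L-lipschitz_on UNIV g"
proof (rule lipschitz_onI)
  fix x y
  have "norm (g x - g y) \<le> L * norm (x - y)"
    by (rule differentiable_bound[of UNIV g g'])
       (use assms in \<open>auto intro: onorm_bound\<close>)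
  then show "dist (g x) (g y) \<le> L * dist x y" by (simp add: dist_norm)
qed fact

section \<open>Finitely many coordinates\<close>

text \<open>Norming functionals of the differences \<open>s - t\<close> of net points suffice:
  replacing \<open>x\<close> by a net point \<open>s\<close> costs \<open>\<delta>\<close> once in
  the norm and once in the functional.\<close>

lemma finite_almost_norming:
  fixes K :: "'b::real_normed_vector set"
  assumes "compact K" "\<delta> > 0"
  obtains S :: "'b set" and N :: nat and \<psi> :: "nat \<Rightarrow> 'b \<Rightarrow> real"
  where "finite S" "\<And>x. x \<in> K \<Longrightarrow> \<exists>s\<in>S. norm (x - s) < \<delta>"
    "\<And>j. j < N \<Longrightarrow> bounded_linear (\<psi> j)" "\<And>j v. j < N \<Longrightarrow> \<bar>\<psi> j v\<bar> \<le> norm v"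
    "\<And>x t. x \<in> K \<Longrightarrow> t \<in> S \<Longrightarrow> \<exists>j<N. norm (x - t) - 2 * \<delta> \<le> \<psi> j (x - t)"
proof -
  obtain S where S: "finite S" "K \<subseteq> (\<Union>s\<in>S. ball s \<delta>)"
    using seq_compact_imp_totally_bounded assms by (metis compact_eq_seq_compact_metric)
  have near: "\<exists>s\<in>S. norm (x - s) < \<delta>" if "x \<in> K" for x
    using subsetD[OF S(2) that] by (auto simp: dist_norm norm_minus_commute)
  have "\<exists>\<phi>. bounded_linear \<phi> \<and> (\<forall>x. \<bar>\<phi> x\<bar> \<le> norm x) \<and> norm v \<le> \<phi> v" for v :: 'b
    by (rule norming_functional[of v]) blast
  then obtain \<phi> :: "'b \<Rightarrow> 'b \<Rightarrow> real" where
    \<phi>: "\<And>v. bounded_linear (\<phi> v)" "\<And>v x. \<bar>\<phi> v x\<bar> \<le> norm x" "\<And>v. norm v \<le> \<phi> v v"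
    by metis
  \<comment> \<open>The pairs are numbered because their functionals become coordinates of
    \<open>linf\<close>.\<close>
  have "finite (S \<times> S)" using S(1) by simp
  from ex_bij_betw_nat_finite[OF this] obtain p where
    p: "bij_betw p {0..<card (S \<times> S)} (S \<times> S)" by blast
  define \<psi> where "\<psi> j = \<phi> (fst (p j) - snd (p j))" for j
  have "\<exists>j<card (S \<times> S). norm (x - t) - 2 * \<delta> \<le> \<psi> j (x - t)" if x: "x \<in> K" and t: "t \<in> S" for x t
  proof -
    from near[OF x] obtain s where s: "s \<in> S" "norm (x - s) < \<delta>" by blast
    with t p obtain j where j: "j < card (S \<times> S)" "p j = (s, t)"
      unfolding bij_betw_def by (auto simp: image_iff set_eq_iff) (metis atLeastLessThan_iff)
    have "\<psi> j (x - t) = \<phi> (s - t) (s - t) + \<phi> (s - t) (x - s)"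
      using linear_simps(1)[OF \<phi>(1), of "s - t" "s - t" "x - s"] by (simp add: \<psi>_def j(2))
    moreover have "norm (x - t) \<le> norm (s - t) + norm (x - s)"
      using norm_triangle_ineq[of "s - t" "x - s"] by simp
    ultimately have "norm (x - t) - 2 * \<delta> \<le> \<psi> j (x - t)"
      using \<phi>(3)[of "s - t"] \<phi>(2)[of "s - t" "x - s"] s(2) by (simp add: abs_le_iff)
    then show ?thesis using j(1) by blast
  qed
  with S(1) near show ?thesis
    using that[of S "card (S \<times> S)" \<psi>] \<phi> by (auto simp: \<psi>_def)
qed

text \<open>The functionals become the first \<open>N\<close> coordinates; the supremum norm makes
  \<open>P\<close> nonexpansive whatever \<open>N\<close> is.\<close>

lemma linf_coordinates:
  fixes \<psi> :: "nat \<Rightarrow> 'b::real_normed_vector \<Rightarrow> real"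
  assumes lin: "\<And>j. j < N \<Longrightarrow> bounded_linear (\<psi> j)" and le: "\<And>j v. j < N \<Longrightarrow> \<bar>\<psi> j v\<bar> \<le> norm v"
  obtains P :: "'b \<Rightarrow> linf" and B where "finite B" "bounded_linear P" "range P \<subseteq> span B"
    "\<And>x j. j < N \<Longrightarrow> apply_bcontfun (P x) j = \<psi> j x" "\<And>x. norm (P x) \<le> norm x"
proof -
  define e :: "nat \<Rightarrow> linf" where "e j = Bcontfun (\<lambda>i. if i = j then 1 else 0)" for j
  have "(\<lambda>i::nat. if i = j then 1 else 0 :: real) \<in> bcontfun" for j
    by (rule bcontfun_normI[of _ 1]) (auto intro: continuous_on_discrete)
  then have e: "apply_bcontfun (e j) i = (if i = j then 1 else 0)" for i j
    by (simp add: e_def Bcontfun_inverse)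
  define P where "P x = (\<Sum>j<N. \<psi> j x *\<^sub>R e j)" for x
  have apply_sum: "apply_bcontfun (\<Sum>j\<in>A. c j *\<^sub>R e j) i = (\<Sum>j\<in>A. c j * apply_bcontfun (e j) i)"
    for c A i by (induction A rule: infinite_finite_induct) auto
  have P: "apply_bcontfun (P x) i = (if i < N then \<psi> i x else 0)" for x i
    by (simp add: P_def apply_sum e if_distrib sum.delta cong: if_cong)
  show ?thesis
  proof (rule that[of "e ` {..<N}" P])
    show "bounded_linear P"
      unfolding P_def by (intro bounded_linear_sum bounded_linear_scaleR_const lin) simp
    show "range P \<subseteq> span (e ` {..<N})"
      unfolding P_def by (intro image_subsetI span_sum span_scale) (auto intro: span_base)
    show "norm (P x) \<le> norm x" for x
      by (rule norm_bound) (auto simp: P le)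
  qed (auto simp: P)
qed

lemma Cyl_I:
  fixes g :: "linf \<Rightarrow> real" and P :: "'b::real_normed_vector \<Rightarrow> linf"
  assumes "finite B" "bounded_linear P" "range P \<subseteq> span B"
    and "g \<in> elementary \<Phi>" "finite \<Phi>" "\<And>\<phi>. \<phi> \<in> \<Phi> \<Longrightarrow> bounded_linear \<phi>"
    and "L-lipschitz_on UNIV g" "\<And>y. m \<le> g y" "\<And>y. g y \<le> M"
  shows "g \<circ> P \<in> Cyl"
proof -
  have "smooth_on (span B) g"
    using elementary_smooth_on assms(4-6) by blast
  moreover have "bounded (g ` span B)"
    by (rule bounded_subset[OF bounded_closed_interval[of m M]]) (use assms(8,9) in auto)
  then have "g \<in> LIP\<^sub>b (span B)"
    using lipschitz_on_subset[OF assms(7)] by (auto simp: LIP\<^sub>b_def)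
  ultimately show ?thesis
    unfolding Cyl_def using assms(1-3) by blast
qed

section \<open>Cones above a Lipschitz function\<close>

text \<open>The segment from \<open>t\<close> to \<open>x\<close> is split at distance
  \<open>\<kappa>\<close> from \<open>t\<close>, still inside the ball. The local constant serves
  the first part, the global one the second.\<close>

lemma geodesic_lipschitz_bound:
  fixes f :: "'b::real_normed_vector \<Rightarrow> real"
  assumes L: "L-lipschitz_on UNIV f" and a: "a-lipschitz_on (ball t r) f"
    and \<kappa>: "0 < \<kappa>" "\<kappa> < r" "\<kappa> \<le> norm (x - t)"
  shows "f x - f t \<le> a * \<kappa> + L * (norm (x - t) - \<kappa>)"
proof -
  define d where "d = norm (x - t)"
  have d: "d > 0" "\<kappa> \<le> d" using \<kappa> by (auto simp: d_def)
  define z where "z = t + (\<kappa> / d) *\<^sub>R (x - t)"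
  have zt: "norm (z - t) = \<kappa>"
    using d \<kappa> by (simp add: z_def d_def)
  have "x - z = (1 - \<kappa> / d) *\<^sub>R (x - t)"
    by (simp add: z_def algebra_simps)
  then have "norm (x - z) = \<bar>1 - \<kappa> / d\<bar> * d"
    by (simp add: d_def)
  also have "\<dots> = d - \<kappa>" using d by (simp add: field_simps)
  finally have xz: "norm (x - z) = d - \<kappa>" .
  have "norm (f z - f t) \<le> a * norm (z - t)"
    using zt \<kappa> by (intro lipschitz_on_normD[OF a]) (auto simp: dist_norm norm_minus_commute)
  moreover have "norm (f x - f z) \<le> L * norm (x - z)"
    by (intro lipschitz_on_normD[OF L]) auto
  ultimately show ?thesis
    unfolding zt xz d_def[symmetric] by (simp add: abs_le_iff)
qed

text \<open>The cone at \<open>t\<close> has the local slope of \<open>f\<close> up to distance \<open>\<kappa>\<close> and the global slope beyond.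
  It stays above \<open>f\<close> because a segment from \<open>t\<close> to \<open>x\<close> spends its first length \<open>\<kappa>\<close> in
  \<open>ball t r\<close>; the excess \<open>\<eta>\<close> in the slope produces the gap that makes distant apexes irrelevant
  near \<open>x\<close>.\<close>

lemma kinked_cone_lower:
  fixes f :: "'b::real_normed_vector \<Rightarrow> real"
  assumes L: "L-lipschitz_on UNIV f" and a: "a-lipschitz_on (ball t r) f" "a \<le> L"
    and "0 < \<kappa>" "\<kappa> < r" "\<eta> > 0" "e \<ge> 0" and p: "norm (x - t) - e \<le> p"
  shows "f x + \<eta> * norm (x - t) - (L + 2 * \<eta>) * e
    \<le> max (f t + (a + \<eta>) * p) (f t + (L + 2 * \<eta>) * p - (L + 2 * \<eta> - (a + \<eta>)) * \<kappa>)"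
proof -
  define d where "d = norm (x - t)"
  have a0: "a \<ge> 0" using a(1) by (rule lipschitz_on_nonneg)
  have L0: "L \<ge> 0" using L by (rule lipschitz_on_nonneg)
  show ?thesis
  proof (cases "d \<le> \<kappa>")
    case True
    then have "norm (f x - f t) \<le> a * d"
      unfolding d_def using assms by (intro lipschitz_on_normD[OF a(1)]) (auto simp: dist_norm norm_minus_commute)
    moreover have "(a + \<eta>) * (d - e) \<le> (a + \<eta>) * p"
      using p a0 assms by (intro mult_left_mono) (auto simp: d_def)
    moreover have "(a + \<eta>) * e \<le> (L + 2 * \<eta>) * e"
      using assms by (intro mult_right_mono) auto
    ultimately have "f x + \<eta> * d - (L + 2 * \<eta>) * e \<le> f t + (a + \<eta>) * p"
      by (simp add: algebra_simps)
    then show ?thesis unfolding d_def by simp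
  next
    case False
    then have "f x - f t \<le> a * \<kappa> + L * (d - \<kappa>)"
      unfolding d_def using assms by (intro geodesic_lipschitz_bound[of L f a t r]) auto
    moreover have "(L + 2 * \<eta>) * (d - e) \<le> (L + 2 * \<eta>) * p"
      using p L0 assms by (intro mult_left_mono) (auto simp: d_def)
    \<comment> \<open>The surplus of the outer piece is
      \<open>2 * \<eta> * d - \<eta> * \<kappa>\<close>, hence at least
      \<open>\<eta> * d\<close>.\<close>
    moreover have "\<eta> * \<kappa> \<le> \<eta> * d"
      using False assms by (intro mult_left_mono) auto
    ultimately have "f x + \<eta> * d - (L + 2 * \<eta>) * e
        \<le> f t + (L + 2 * \<eta>) * p - (L + 2 * \<eta> - (a + \<eta>)) * \<kappa>"
      by (simp add: algebra_simps)
    then show ?thesis unfolding d_def by simp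
  qed
qed

section \<open>Choice of the parameter and correction of the range\<close>

lemma large_parameter:
  fixes c1 c2 c3 e k :: real
  assumes "c1 \<ge> 0" "c2 \<ge> 0" "c3 \<ge> 0" "e > 0" "k > 0"
  obtains \<theta> where "\<theta> > 0" "c1 / \<theta> \<le> e" "c2 / \<theta> \<le> e" "c3 * exp (- (\<theta> * k)) \<le> e"
proof
  \<comment> \<open>One summand per condition, and \<open>1\<close> for positivity. The linear
    estimate \<open>u \<le> exp u\<close> suffices for the exponential condition.\<close>
  define \<theta> where "\<theta> = 1 + c1 / e + c2 / e + c3 / (e * k)"
  have nn: "c1 / e \<ge> 0" "c2 / e \<ge> 0" "c3 / (e * k) \<ge> 0" using assms by auto
  then show pos: "\<theta> > 0" by (simp add: \<theta>_def)
  have "c1 / e \<le> \<theta>" "c2 / e \<le> \<theta>" using nn by (simp_all add: \<theta>_def)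
  then show "c1 / \<theta> \<le> e" "c2 / \<theta> \<le> e" using pos assms by (simp_all add: field_simps)
  have "c3 / (e * k) \<le> \<theta>" using nn by (simp add: \<theta>_def)
  then have "c3 \<le> e * (\<theta> * k)" using assms by (simp add: field_simps)
  also have "\<theta> * k \<le> exp (\<theta> * k)"
    using exp_ge_add_one_self[of "\<theta> * k"] by linarith
  then have "e * (\<theta> * k) \<le> e * exp (\<theta> * k)"
    using assms by (intro mult_left_mono) auto
  finally show "c3 * exp (- (\<theta> * k)) \<le> e"
    by (simp add: exp_minus field_simps)
qed

text \<open>This is the affine map sending \<open>m - \<tau>\<close> to \<open>m\<close> and fixing
  \<open>M\<close>. It repairs the drop of the soft minimum below \<open>m\<close> without
  increasing slopes; for \<open>m = M\<close> it is constant.\<close>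

lemma affine_rescale:
  fixes m M \<tau> u :: real
  assumes "m \<le> M" "\<tau> > 0" "m - \<tau> \<le> u" "u \<le> M"
  defines "\<rho> \<equiv> (M - m) / (M - m + \<tau>)"
  shows "0 \<le> \<rho>" "\<rho> \<le> 1" "m \<le> m - \<rho> * (m - \<tau>) + \<rho> * u" "m - \<rho> * (m - \<tau>) + \<rho> * u \<le> M"
    "\<bar>m - \<rho> * (m - \<tau>) + \<rho> * u - u\<bar> \<le> \<tau>"
proof -
  show 0: "0 \<le> \<rho>" and 1: "\<rho> \<le> 1" using assms by (auto simp: \<rho>_def)
  have \<rho>: "\<rho> * (M - m + \<tau>) = M - m" using assms by (simp add: \<rho>_def)
  have eq: "m - \<rho> * (m - \<tau>) + \<rho> * u = m + \<rho> * (u - m + \<tau>)" by (simp add: algebra_simps)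
  have "0 \<le> \<rho> * (u - m + \<tau>)" using 0 assms by (intro mult_nonneg_nonneg) auto
  then show "m \<le> m - \<rho> * (m - \<tau>) + \<rho> * u" unfolding eq by simp
  have "\<rho> * (u - m + \<tau>) \<le> \<rho> * (M - m + \<tau>)" using 0 assms by (intro mult_left_mono) auto
  then show "m - \<rho> * (m - \<tau>) + \<rho> * u \<le> M" unfolding eq \<rho> by simp
  have "0 \<le> (1 - \<rho>) * (u - m + \<tau>)" using 1 assms by (intro mult_nonneg_nonneg) auto
  moreover have "(1 - \<rho>) * (u - m + \<tau>) \<le> (1 - \<rho>) * (M - m + \<tau>)"
    using 1 assms by (intro mult_left_mono) auto
  ultimately show "\<bar>m - \<rho> * (m - \<tau>) + \<rho> * u - u\<bar> \<le> \<tau>"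
    unfolding eq abs_le_iff using \<rho> by (simp add: algebra_simps)
qed

section \<open>Approximation on compact sets\<close>

text \<open>In the last bound one \<open>\<eta>\<close> is the surplus slope of the cones, the other
  pays for inactive pieces. The radius is \<open>2 * r\<close> because an apex within
  \<open>r\<close> of \<open>x\<close> brings the slope of its own ball of radius
  \<open>r\<close>.\<close>

lemma compact_cylindrical_approximation:
  fixes f :: "'b::real_normed_vector \<Rightarrow> real"
  assumes f: "f \<in> LIP\<^sub>b UNIV" and K: "compact K" and r: "r > 0" and \<eta>: "\<eta> > 0"
  obtains h where "h \<in> Cyl" "\<And>x. (INF y. f y) \<le> h x" "\<And>x. h x \<le> (SUP y. f y)"
    "Lip h UNIV \<le> Lip f UNIV + 2 * \<eta>"
    "\<And>x. x \<in> K \<Longrightarrow> \<bar>h x - f x\<bar> \<le> \<eta>"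
    "\<And>x. x \<in> K \<Longrightarrow> onorm (frechet_derivative h (at x)) \<le> Lip f (ball x (2 * r)) + 2 * \<eta>"
proof -
  obtain L0 where L0: "L0-lipschitz_on UNIV f" and bdd: "bounded (range f)"
    using f by (auto simp: LIP\<^sub>b_def)
  define L where "L = Lip f UNIV"
  have L: "L-lipschitz_on UNIV f" unfolding L_def using L0 by (rule lipschitz_on_Lip)
  then have L_nonneg: "L \<ge> 0" by (rule lipschitz_on_nonneg)
  define m M where "m = (INF y. f y)" and "M = (SUP y. f y)"
  have m_le: "m \<le> f x" and le_M: "f x \<le> M" for x
    unfolding m_def M_def using bdd
    by (auto intro!: cINF_lower cSUP_upper bounded_imp_bdd_below bounded_imp_bdd_above)
  then have mM: "m \<le> M" using order_trans by blast
  define \<kappa> where "\<kappa> = r / 2"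
  define \<Lambda> where "\<Lambda> = L + 2 * \<eta>"
  have \<kappa>: "0 < \<kappa>" "\<kappa> < r" using r by (auto simp: \<kappa>_def)
  have \<Lambda>: "\<Lambda> > 0" using L_nonneg \<eta> by (simp add: \<Lambda>_def)
  define a where "a t = Lip f (ball t r)" for t
  have a: "(a t)-lipschitz_on (ball t r) f" "a t \<le> L" for t
    unfolding a_def L_def using lipschitz_on_subset[OF L0]
    by (auto intro!: lipschitz_on_Lip Lip_mono[OF L0])
  have a_nonneg: "a t \<ge> 0" for t using a(1) by (rule lipschitz_on_nonneg)
  \<comment> \<open>Makes \<open>4 * \<Lambda> * \<delta>\<close> at most
    \<open>\<eta> * \<kappa> / 4\<close>, for the gap between cones, and
    \<open>2 * \<Lambda> * \<delta>\<close> at most \<open>\<eta> / 8\<close>, for the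
    accuracy.\<close>
  define \<delta> where "\<delta> = min (\<eta> * \<kappa>) \<eta> / (16 * \<Lambda>)"
  have \<delta>: "\<delta> > 0" "16 * \<Lambda> * \<delta> \<le> \<eta> * \<kappa>" "16 * \<Lambda> * \<delta> \<le> \<eta>"
    using \<Lambda> \<eta> \<kappa> by (auto simp: \<delta>_def)
  obtain S :: "'b set" and N :: nat and \<psi> :: "nat \<Rightarrow> 'b \<Rightarrow> real" where
    S: "finite S" "\<And>x. x \<in> K \<Longrightarrow> \<exists>s\<in>S. norm (x - s) < \<delta>" and
    \<psi>: "\<And>j. j < N \<Longrightarrow> bounded_linear (\<psi> j)" "\<And>j v. j < N \<Longrightarrow> \<bar>\<psi> j v\<bar> \<le> norm v" and
    norming: "\<And>x t. x \<in> K \<Longrightarrow> t \<in> S \<Longrightarrow> \<exists>j<N. norm (x - t) - 2 * \<delta> \<le> \<psi> j (x - t)"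
    by (rule finite_almost_norming[OF K \<delta>(1)]) blast
  obtain P :: "'b \<Rightarrow> linf" and B where
    P: "finite B" "bounded_linear P" "range P \<subseteq> span B"
      "\<And>x j. j < N \<Longrightarrow> apply_bcontfun (P x) j = \<psi> j x" "\<And>x. norm (P x) \<le> norm x"
    using linf_coordinates[of N \<psi>] \<psi> by metis
  \<comment> \<open>The Boolean selects the piece of the cone: \<open>False\<close> the inner one,
    \<open>True\<close> the outer one.\<close>
  define I where "I = {..<N} \<times> (UNIV :: bool set)"
  define n where "n = 1 + real (card I)"
  have n: "n \<ge> 1" by (simp add: n_def)
  \<comment> \<open>The conditions bound the errors of the soft minimum and of the soft maximum and
    the influence of inactive pieces.\<close>
  obtain \<theta> where \<theta>: "\<theta> > 0" "ln (1 + real (card S)) / \<theta> \<le> \<eta> / 4" "ln n / \<theta> \<le> \<eta> / 4"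
    "(\<Lambda> * real (card S) * real (card I) * n) * exp (- (\<theta> * (\<eta> * \<kappa> / 4))) \<le> \<eta> / 4"
    using large_parameter[of "ln (1 + real (card S))" "ln n" "\<Lambda> * real (card S) * real (card I) * n"
        "\<eta> / 4" "\<eta> * \<kappa> / 4"] \<Lambda> \<eta> \<kappa> n by auto
  define l where "l i y = apply_bcontfun y (fst i)" for i :: "nat \<times> bool" and y :: linf
  define \<sigma> where "\<sigma> t i = (if snd i then \<Lambda> else a t + \<eta>)" for t and i :: "nat \<times> bool"
  \<comment> \<open>Recentres the functionals at the apex and makes both pieces agree where the
    functional equals \<open>\<kappa>\<close>.\<close>
  define \<beta> where "\<beta> t i = f t - \<sigma> t i * \<psi> (fst i) t - (if snd i then (\<Lambda> - (a t + \<eta>)) * \<kappa> else 0)"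
    for t and i :: "nat \<times> bool"
  have l_le: "\<bar>l i v\<bar> \<le> norm v" for i v
    unfolding l_def using norm_bounded[of v "fst i"] by simp
  have lin_l: "bounded_linear (l i)" for i
    by (rule bounded_linear_intro[where K = 1]) (use l_le[of i] in \<open>auto simp: l_def\<close>)
  have \<sigma>_nonneg: "\<sigma> t i \<ge> 0" for t i
    using a_nonneg[of t] \<Lambda> \<eta> by (simp add: \<sigma>_def)
  have finite_I: "finite I" by (simp add: I_def)
  interpret soft_min_max S I l \<sigma> \<beta> \<theta> m M
    by (rule soft_min_max.intro) (auto simp: S(1) \<theta>(1) finite_I intro: lin_l l_le \<sigma>_nonneg)
  have \<sigma>_le: "\<sigma> t i \<le> \<Lambda>" for t i
    using a(2)[of t] \<eta> by (simp add: \<sigma>_def \<Lambda>_def)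

  have \<alpha>_P: "\<alpha> t (j, b) (P x) = f t + \<sigma> t (j, b) * \<psi> j (x - t) - (if b then (\<Lambda> - (a t + \<eta>)) * \<kappa> else 0)"
    if "j < N" for t j b x
    unfolding linear_simps(2)[OF \<psi>(1)[OF that]]
    using P(4)[OF that] by (simp add: \<alpha>_def \<beta>_def l_def right_diff_distrib)
  have Z_lower: "exp (\<theta> * (f x + \<eta> * norm (x - t) - 2 * \<Lambda> * \<delta>)) \<le> Z t (P x)"
    if x: "x \<in> K" and t: "t \<in> S" for x t
  proof -
    obtain j where j: "j < N" "norm (x - t) - 2 * \<delta> \<le> \<psi> j (x - t)"
      using norming[OF x t] by blast
    have "f x + \<eta> * norm (x - t) - \<Lambda> * (2 * \<delta>) \<le> max (\<alpha> t (j, False) (P x)) (\<alpha> t (j, True) (P x))"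
      using kinked_cone_lower[OF L a(1,2) \<kappa> \<eta> _ j(2)] \<delta>(1)
      by (simp add: \<alpha>_P[OF j(1)] \<sigma>_def \<Lambda>_def)
    then obtain b where "f x + \<eta> * norm (x - t) - \<Lambda> * (2 * \<delta>) \<le> \<alpha> t (j, b) (P x)"
      by (auto simp: le_max_iff_disj)
    then have "exp (\<theta> * (f x + \<eta> * norm (x - t) - 2 * \<Lambda> * \<delta>)) \<le> exp (\<theta> * \<alpha> t (j, b) (P x))"
      using \<theta>(1) by (simp add: ac_simps)
    also have "\<dots> \<le> Z t (P x)"
      using j(1) by (intro Z_ge) (simp add: I_def)
    finally show ?thesis .
  qed
  \<comment> \<open>One \<open>\<Lambda> * \<delta>\<close> pays for \<open>f s - f x\<close>, the
    other for the rise of the cone between \<open>s\<close> and \<open>x\<close>.\<close>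
  have Z_upper: "Z s (P x) \<le> n * exp (\<theta> * (f x + 2 * \<Lambda> * \<delta>))" if s: "norm (x - s) < \<delta>" for x s
  proof -
    have fs: "f s - f x \<le> L * \<delta>"
    proof -
      have "norm (f s - f x) \<le> L * norm (s - x)"
        by (intro lipschitz_on_normD[OF L]) auto
      also have "\<dots> \<le> L * \<delta>"
        using s L_nonneg by (intro mult_left_mono) (auto simp: norm_minus_commute)
      finally show ?thesis by simp
    qed
    have L\<Lambda>: "L * \<delta> \<le> \<Lambda> * \<delta>"
      using \<delta> \<eta> by (intro mult_right_mono) (auto simp: \<Lambda>_def)
    have "\<alpha> s i (P x) \<le> f x + 2 * \<Lambda> * \<delta>" if i: "i \<in> I" for i
    proof -
      obtain j b where jb: "i = (j, b)" "j < N" using i by (auto simp: I_def)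
      have "\<psi> j (x - s) \<le> \<delta>"
        using \<psi>(2)[OF jb(2), of "x - s"] s by (simp add: abs_le_iff)
      then have "\<sigma> s i * \<psi> j (x - s) \<le> \<sigma> s i * \<delta>"
        using a_nonneg[of s] \<eta> \<Lambda> by (intro mult_left_mono) (auto simp: \<sigma>_def)
      also have "\<dots> \<le> \<Lambda> * \<delta>"
        using \<delta>(1) \<sigma>_le by (intro mult_right_mono) auto
      finally have "\<sigma> s i * \<psi> j (x - s) \<le> \<Lambda> * \<delta>" .
      moreover have "0 \<le> (\<Lambda> - (a s + \<eta>)) * \<kappa>"
        using a(2)[of s] \<eta> \<kappa> by (intro mult_nonneg_nonneg) (auto simp: \<Lambda>_def)
      ultimately show ?thesis
        using fs L\<Lambda> by (auto simp: \<alpha>_P jb)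
    qed
    then have "(\<Sum>i\<in>I. exp (\<theta> * \<alpha> s i (P x))) \<le> real (card I) * exp (\<theta> * (f x + 2 * \<Lambda> * \<delta>))"
      using \<theta>(1) by (intro sum_bounded_above) simp
    moreover have "exp (\<theta> * m) \<le> exp (\<theta> * (f x + 2 * \<Lambda> * \<delta>))"
      using m_le[of x] \<Lambda> \<delta>(1) \<theta>(1) by (simp add: add_increasing2)
    ultimately show ?thesis
      unfolding Z_def n_def distrib_right mult_1_left by (rule add_mono[rotated])
  qed

  have F_near: "\<bar>F (P x) - f x\<bar> \<le> \<eta> / 2" if x: "x \<in> K" for x
  proof -
    obtain s where s: "s \<in> S" "norm (x - s) < \<delta>" using S(2)[OF x] by blast
    have "F (P x) \<le> f x + 2 * \<Lambda> * \<delta> + ln n / \<theta>"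
      using s n by (intro F_le[OF s(1)] Z_upper) auto
    moreover have "f x - 2 * \<Lambda> * \<delta> - ln (1 + real (card S)) / \<theta> \<le> F (P x)"
    proof (rule F_ge)
      fix t assume t: "t \<in> S"
      have "exp (\<theta> * (f x - 2 * \<Lambda> * \<delta>)) \<le> exp (\<theta> * (f x + \<eta> * norm (x - t) - 2 * \<Lambda> * \<delta>))"
        using \<theta>(1) \<eta> by simp
      with Z_lower[OF x t] show "exp (\<theta> * (f x - 2 * \<Lambda> * \<delta>)) \<le> Z t (P x)" by linarith
    next
      have "0 \<le> \<Lambda> * \<delta>" using \<Lambda> \<delta>(1) by simp
      then show "f x - 2 * \<Lambda> * \<delta> \<le> M" using le_M[of x] by simp
    qed
    ultimately show ?thesis using \<theta>(2,3) \<delta>(3) unfolding abs_le_iff by linarith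
  qed
  define \<tau> where "\<tau> = \<eta> / 4"
  have \<tau>: "\<tau> > 0" using \<eta> by (simp add: \<tau>_def)
  \<comment> \<open>Holds on all of \<open>linf\<close>, since every branch contains
    \<open>m\<close>.\<close>
  have F_ge_m: "m - \<tau> \<le> F y" for y
    using F_ge[of m y] Z_ge_m mM \<theta>(2) by (simp add: \<tau>_def)

  define DF where "DF y v = (\<Sum>t\<in>S. \<Sum>i\<in>I. W y t i * (\<sigma> t i * l i v))" for y v
  have F_der: "(F has_derivative DF y) (at y)" for y
    unfolding DF_def by (rule F_has_derivative)
  \<comment> \<open>With \<open>C = \<Lambda>\<close> no pair is too steep, so
    \<open>\<omega> = 0\<close> is allowed.\<close>
  have DF_global: "\<bar>DF y v\<bar> \<le> \<Lambda> * norm v" for y v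
    unfolding DF_def using derivative_bound[of \<Lambda> 0 \<Lambda> y v] \<Lambda> \<sigma>_le by simp
  have DF_local: "\<bar>DF (P x) v\<bar> \<le> (Lip f (ball x (2 * r)) + 2 * \<eta>) * norm v" if x: "x \<in> K" for x v
  proof -
    define C where "C = Lip f (ball x (2 * r)) + \<eta>"
    define \<omega> where "\<omega> = n * exp (- (\<theta> * (\<eta> * \<kappa> / 4)))"
    have "0 \<le> Lip f (ball x (2 * r))"
      using lipschitz_on_nonneg[OF lipschitz_on_Lip[OF lipschitz_on_subset[OF L0]]] by blast
    then have C: "C \<ge> 0" using \<eta> by (simp add: C_def)
    have \<omega>: "\<omega> \<ge> 0" using n by (simp add: \<omega>_def)
    obtain s where s: "s \<in> S" "norm (x - s) < \<delta>" using S(2)[OF x] by blast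
    have "\<sigma> t i \<le> C \<or> W (P x) t i \<le> \<omega>" if t: "t \<in> S" and i: "i \<in> I" for t i
    \<comment> \<open>At a near apex the outer piece has little weight and the inner one a small
      slope; a far apex loses against \<open>s\<close>.\<close>
    proof (cases "norm (x - t) < \<kappa> / 2")
      case near: True
      obtain j b where jb: "i = (j, b)" "j < N" using i by (auto simp: I_def)
      show ?thesis
      proof (cases b)
        case True
        \<comment> \<open>The slopes differ by at least \<open>\<eta>\<close> because
          \<open>a t \<le> L\<close>, and the functional stays below
          \<open>\<kappa> / 2\<close>.\<close>
        have "\<eta> * (\<kappa> / 2) \<le> (\<Lambda> - (a t + \<eta>)) * (\<kappa> - \<psi> j (x - t))"
          using a(2)[of t] \<psi>(2)[OF jb(2), of "x - t"] near \<eta> \<kappa>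
          by (intro mult_mono) (auto simp: \<Lambda>_def abs_le_iff)
        then have gap: "\<alpha> t i (P x) + \<eta> * \<kappa> / 2 \<le> \<alpha> t (j, False) (P x)"
          using True by (simp add: jb \<alpha>_P \<sigma>_def algebra_simps)
        have "\<eta> * \<kappa> / 4 \<le> \<alpha> t (j, False) (P x) - \<alpha> t i (P x)"
          using gap mult_pos_pos[OF \<eta> \<kappa>(1)] by simp
        then have "\<theta> * (\<eta> * \<kappa> / 4) \<le> \<theta> * (\<alpha> t (j, False) (P x) - \<alpha> t i (P x))"
          using \<theta>(1) by (intro mult_left_mono) auto
        then have "exp (\<theta> * \<alpha> t i (P x)) \<le> exp (- (\<theta> * (\<eta> * \<kappa> / 4))) * exp (\<theta> * \<alpha> t (j, False) (P x))"
          by (simp add: exp_add[symmetric] algebra_simps)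
        also have "\<dots> \<le> exp (- (\<theta> * (\<eta> * \<kappa> / 4))) * Z t (P x)"
          using jb by (intro mult_left_mono Z_ge) (auto simp: I_def)
        finally have "exp (\<theta> * \<alpha> t i (P x)) / Z t (P x) \<le> exp (- (\<theta> * (\<eta> * \<kappa> / 4)))"
          using Z_pos[of t "P x"] by (simp add: field_simps)
        also have "\<dots> \<le> \<omega>"
          using n by (simp add: \<omega>_def)
        finally show ?thesis using W_le_branch[OF t, of "P x" i] by simp
      next
        case False
        have xt: "dist x t < r" using near \<kappa> by (simp add: dist_norm)
        have "ball t r \<subseteq> ball x (2 * r)"
        proof
          fix y assume "y \<in> ball t r"
          with xt dist_triangle[of x y t] show "y \<in> ball x (2 * r)" by simp
        qed
        then have "a t \<le> Lip f (ball x (2 * r))"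
          unfolding a_def by (intro Lip_mono[OF lipschitz_on_subset[OF L0]]) auto
        then show ?thesis using False by (simp add: jb \<sigma>_def C_def)
      qed
    next
      case False
      \<comment> \<open>The surplus slope gains \<open>\<eta> * \<kappa> / 2\<close>, the comparison
        with \<open>s\<close> costs \<open>4 * \<Lambda> * \<delta>\<close>, so a gap of
        \<open>\<eta> * \<kappa> / 4\<close> remains.\<close>
      then have "\<eta> * (\<kappa> / 2) \<le> \<eta> * norm (x - t)" using \<eta> by (intro mult_left_mono) auto
      then have "(f x + 2 * \<Lambda> * \<delta>) + \<eta> * \<kappa> / 4 \<le> f x + \<eta> * norm (x - t) - 2 * \<Lambda> * \<delta>"
        using \<delta>(2) by simp
      then have "\<theta> * ((f x + 2 * \<Lambda> * \<delta>) + \<eta> * \<kappa> / 4) \<le> \<theta> * (f x + \<eta> * norm (x - t) - 2 * \<Lambda> * \<delta>)"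
        using \<theta>(1) by (intro mult_left_mono) auto
      then have "exp (\<theta> * ((f x + 2 * \<Lambda> * \<delta>) + \<eta> * \<kappa> / 4)) \<le> Z t (P x)"
        using Z_lower[OF x t] by (meson exp_le_cancel_iff order_trans)
      then have "\<omega> * exp (\<theta> * ((f x + 2 * \<Lambda> * \<delta>) + \<eta> * \<kappa> / 4)) \<le> \<omega> * Z t (P x)"
        using \<omega> by (rule mult_left_mono)
      moreover have "\<omega> * exp (\<theta> * ((f x + 2 * \<Lambda> * \<delta>) + \<eta> * \<kappa> / 4)) = n * exp (\<theta> * (f x + 2 * \<Lambda> * \<delta>))"
        by (simp add: \<omega>_def mult.assoc exp_add[symmetric] distrib_left)
      ultimately have "Z s (P x) \<le> \<omega> * Z t (P x)"
        using Z_upper[OF s(2)] by linarith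
      then have "Z s (P x) / Z t (P x) \<le> \<omega>"
        using Z_pos[of t "P x"] by (simp add: field_simps)
      then show ?thesis using W_le_ratio[OF i s(1), of "P x" t] by simp
    qed
    then have "\<bar>DF (P x) v\<bar> \<le> (C + \<Lambda> * (real (card S) * real (card I) * \<omega>)) * norm v"
      unfolding DF_def using C \<omega> \<Lambda> \<sigma>_le by (intro derivative_bound) auto
    also have "\<Lambda> * (real (card S) * real (card I) * \<omega>) \<le> \<eta>"
      using \<theta>(4) \<eta> by (simp add: \<omega>_def mult.assoc)
    then have "(C + \<Lambda> * (real (card S) * real (card I) * \<omega>)) * norm v \<le> (C + \<eta>) * norm v"
      by (intro mult_right_mono) auto
    finally show ?thesis by (simp add: C_def algebra_simps)
  qed

  define \<rho> where "\<rho> = (M - m) / (M - m + \<tau>)"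
  note rescale = affine_rescale[OF mM \<tau> F_ge_m F_le_M, folded \<rho>_def]
  \<comment> \<open>As \<open>0 \<le> \<rho> \<le> 1\<close>, all derivative bounds survive while
    the values return to the interval from \<open>m\<close> to \<open>M\<close>.\<close>
  define g where "g y = m - \<rho> * (m - \<tau>) + \<rho> * F y" for y
  have g_der: "(g has_derivative (\<lambda>v. \<rho> * DF y v)) (at y)" for y
    unfolding g_def using F_der[of y] by (auto intro!: derivative_eq_intros)
  have \<rho>_le: "\<bar>\<rho> * z\<bar> \<le> \<bar>z\<bar>" for z
    using rescale(1,2) by (simp add: abs_mult mult_left_le_one_le)
  have g_lip: "\<Lambda>-lipschitz_on UNIV g"
    using \<rho>_le DF_global \<Lambda> by (intro lipschitz_on_derivative_bound[OF g_der]) (auto intro: order_trans)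
  have h_der: "(g \<circ> P has_derivative (\<lambda>v. \<rho> * DF (P x) (P v))) (at x)" for x
    unfolding comp_def
    by (rule has_derivative_compose[OF bounded_linear_imp_has_derivative[OF P(2)] g_der])
  show ?thesis
  proof (rule that[of "g \<circ> P"])
    show "g \<circ> P \<in> Cyl"
    proof (rule Cyl_I[OF P(1-3)])
      show "g \<in> elementary (l ` I)"
        unfolding g_def by (intro elementary.add elementary.const elementary_cmult F_elementary)
      show "finite (l ` I)" by (simp add: I_def)
      show "\<Lambda>-lipschitz_on UNIV g" by (rule g_lip)
      show "m \<le> g y" "g y \<le> M" for y unfolding g_def using rescale(3,4) by auto
    qed (use lin_l in auto)
    show "(INF y. f y) \<le> (g \<circ> P) x" "(g \<circ> P) x \<le> (SUP y. f y)" for x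
      unfolding g_def m_def[symmetric] M_def[symmetric] comp_def using rescale(3,4) by auto
    have "\<bar>\<rho> * DF (P x) (P v)\<bar> \<le> \<Lambda> * norm v" for x v
      using \<rho>_le[of "DF (P x) (P v)"] DF_global[of "P x" "P v"] mult_left_mono[OF P(5) less_imp_le[OF \<Lambda>], of v]
      by linarith
    then have "\<Lambda>-lipschitz_on UNIV (g \<circ> P)"
      using \<Lambda> by (intro lipschitz_on_derivative_bound[OF h_der]) auto
    then have "Lip (g \<circ> P) UNIV \<le> \<Lambda>" by (rule Lip_le)
    then show "Lip (g \<circ> P) UNIV \<le> Lip f UNIV + 2 * \<eta>"
      by (simp add: \<Lambda>_def L_def)
    show "\<bar>(g \<circ> P) x - f x\<bar> \<le> \<eta>" if "x \<in> K" for x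
    proof -
      have "\<bar>g (P x) - F (P x)\<bar> \<le> \<tau>"
        unfolding g_def by (rule rescale(5))
      with F_near[OF that] \<eta> show ?thesis
        unfolding \<tau>_def comp_def by linarith
    qed
    show "onorm (frechet_derivative (g \<circ> P) (at x)) \<le> Lip f (ball x (2 * r)) + 2 * \<eta>" if x: "x \<in> K" for x
    proof -
      define C where "C = Lip f (ball x (2 * r)) + 2 * \<eta>"
      have "0 \<le> Lip f (ball x (2 * r))"
        using lipschitz_on_nonneg[OF lipschitz_on_Lip[OF lipschitz_on_subset[OF L0]]] by blast
      then have C: "C \<ge> 0" using \<eta> by (simp add: C_def)
      have "\<bar>\<rho> * DF (P x) (P v)\<bar> \<le> C * norm v" for v
        using \<rho>_le[of "DF (P x) (P v)"] DF_local[OF x, of "P v", folded C_def] mult_left_mono[OF P(5) C, of v]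
        by linarith
      then show ?thesis
        unfolding frechet_derivative_at[OF h_der, symmetric] C_def[symmetric]
        using C by (intro onorm_bound) auto
    qed
  qed
qed

section \<open>Exhaustion by compact sets and passage to the limit\<close>

theorem theorem3p2:
  fixes E :: "'b::banach set" and f :: "'b \<Rightarrow> real" and \<epsilon> :: real
  assumes "sigma_compact E"
    and "f \<in> LIP\<^sub>b UNIV"
    and "\<epsilon> > 0"
  shows "\<exists>fs :: nat \<Rightarrow> 'b \<Rightarrow> real.
    (\<forall>n. fs n \<in> Cyl) \<and>
    (\<forall>n. (\<forall>x. (INF y. f y) \<le> fs n x \<and> fs n x \<le> (SUP y. f y)) \<and>
         Lip (fs n) UNIV \<le> Lip f UNIV + \<epsilon>) \<and>
    (\<forall>x\<in>E. (\<lambda>n. fs n x) \<longlonglongrightarrow> f x) \<and>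
    (\<forall>x\<in>E. limsup (\<lambda>n. ereal (onorm (frechet_derivative (fs n) (at x)))) \<le> ereal (lip\<^sub>a f x))"
proof -
  obtain \<K> where \<K>: "countable \<K>" "\<And>K. K \<in> \<K> \<Longrightarrow> compact K" "E = \<Union>\<K>"
    using assms(1) by (auto simp: sigma_compact_def)
  \<comment> \<open>Inserting the empty set makes the family nonempty, so that it can be enumerated
    even if \<open>\<K>\<close> is empty.\<close>
  define A where "A = from_nat_into (insert {} \<K>)"
  have range_A: "range A = insert {} \<K>"
    unfolding A_def using \<K>(1) by (intro range_from_nat_into) auto
  define K where "K n = (\<Union>i\<le>n. A i)" for n
  have "compact (A i)" for i
    using range_A \<K>(2) by (metis compact_empty insert_iff rangeI)
  then have K: "compact (K n)" for n
    unfolding K_def by (intro compact_UN) auto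
  have ev_K: "\<forall>\<^sub>F n in sequentially. x \<in> K n" if x: "x \<in> E" for x
  proof -
    from x \<K>(3) range_A obtain i where "x \<in> A i" by blast
    then have "x \<in> K n" if "n \<ge> i" for n using that by (auto simp: K_def)
    then show ?thesis by (auto simp: eventually_sequentially)
  qed
  obtain L where L: "L-lipschitz_on UNIV f" using assms(2) by (auto simp: LIP\<^sub>b_def)
  define r where "r n = inverse (real (Suc n))" for n
  \<comment> \<open>The cap \<open>\<epsilon> / 2\<close> is due to the loss of
    \<open>2 * \<eta> n\<close> in the Lipschitz constant.\<close>
  define \<eta> where "\<eta> n = min (\<epsilon> / 2) (r n)" for n
  have r: "r n > 0" and \<eta>: "\<eta> n > 0" for n using assms(3) by (auto simp: r_def \<eta>_def)
  have r0: "r \<longlonglongrightarrow> 0" unfolding r_def by (rule LIMSEQ_inverse_real_of_nat)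
  have \<eta>0: "\<eta> \<longlonglongrightarrow> 0"
    using tendsto_min[OF tendsto_const r0, of "\<epsilon> / 2"] assms(3) by (simp add: \<eta>_def[abs_def])
  have "\<exists>h. h \<in> Cyl \<and> (\<forall>x. (INF y. f y) \<le> h x \<and> h x \<le> (SUP y. f y)) \<and>
    Lip h UNIV \<le> Lip f UNIV + 2 * \<eta> n \<and> (\<forall>x\<in>K n. \<bar>h x - f x\<bar> \<le> \<eta> n) \<and>
    (\<forall>x\<in>K n. onorm (frechet_derivative h (at x)) \<le> Lip f (ball x (2 * r n)) + 2 * \<eta> n)" for n
    by (rule compact_cylindrical_approximation[OF assms(2) K r \<eta>, of n n n]) blast
  then obtain h where h: "\<And>n. h n \<in> Cyl"
    "\<And>n x. (INF y. f y) \<le> h n x \<and> h n x \<le> (SUP y. f y)"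
    "\<And>n. Lip (h n) UNIV \<le> Lip f UNIV + 2 * \<eta> n"
    "\<And>n x. x \<in> K n \<Longrightarrow> \<bar>h n x - f x\<bar> \<le> \<eta> n"
    "\<And>n x. x \<in> K n \<Longrightarrow> onorm (frechet_derivative (h n) (at x)) \<le> Lip f (ball x (2 * r n)) + 2 * \<eta> n"
    by metis
  have "Lip (h n) UNIV \<le> Lip f UNIV + \<epsilon>" for n
    using h(3)[of n] by (simp add: \<eta>_def)
  moreover have "(\<lambda>n. h n x) \<longlonglongrightarrow> f x" if x: "x \<in> E" for x
  proof (rule LIM_zero_cancel, rule Lim_null_comparison[OF _ \<eta>0])
    show "\<forall>\<^sub>F n in sequentially. norm (h n x - f x) \<le> \<eta> n"
      using ev_K[OF x] by eventually_elim (simp add: h(4))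
  qed
  moreover have "limsup (\<lambda>n. ereal (onorm (frechet_derivative (h n) (at x)))) \<le> ereal (lip\<^sub>a f x)"
    (is "?l \<le> _") if x: "x \<in> E" for x
  proof -
    \<comment> \<open>The radius \<open>s\<close> stays fixed while \<open>n\<close> grows; the
      infimum over \<open>s\<close> is taken afterwards.\<close>
    have bound: "?l \<le> ereal (Lip f (ball x s))" if s: "s > 0" for s
    proof -
      have "(\<lambda>n. 2 * r n) \<longlonglongrightarrow> 0" using tendsto_mult_left[OF r0, of 2] by simp
      then have "\<forall>\<^sub>F n in sequentially. 2 * r n < s" by (rule order_tendstoD) (rule s)
      then have "\<forall>\<^sub>F n in sequentially.
          ereal (onorm (frechet_derivative (h n) (at x))) \<le> ereal (Lip f (ball x s) + 2 * \<eta> n)"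
        using ev_K[OF x]
      proof eventually_elim
        case (elim n)
        have "Lip f (ball x (2 * r n)) \<le> Lip f (ball x s)"
          using elim(1) by (intro Lip_mono[OF lipschitz_on_subset[OF L]] subset_ball) auto
        with h(5)[OF elim(2)] show ?case by simp
      qed
      then have "?l \<le> limsup (\<lambda>n. ereal (Lip f (ball x s) + 2 * \<eta> n))"
        by (rule Limsup_mono)
      also have "(\<lambda>n. ereal (Lip f (ball x s) + 2 * \<eta> n)) \<longlonglongrightarrow> ereal (Lip f (ball x s) + 2 * 0)"
        by (intro tendsto_intros \<eta>0)
      then have "limsup (\<lambda>n. ereal (Lip f (ball x s) + 2 * \<eta> n)) = ereal (Lip f (ball x s))"
        by (intro lim_imp_Limsup) auto
      finally show ?thesis .
    qed
    show ?thesis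
    \<comment> \<open>The infimum over radii is taken in the reals, so infinite values are treated
      apart: any one radius excludes infinity, and minus infinity is trivial.\<close>
    proof (cases ?l)
      case (real b)
      have "b \<le> lip\<^sub>a f x"
        unfolding lip\<^sub>a_def
      proof (rule cINF_greatest)
        fix s :: real assume "s \<in> {0<..}"
        with bound[of s] real show "b \<le> Lip f (ball x s)" by simp
      qed auto
      with real show ?thesis by simp
    next
      case PInf
      with bound[of 1] show ?thesis by simp
    qed simp
  qed
  ultimately show ?thesis
    using h(1,2) by (intro exI[of _ h]) blast
qed

end
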